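(* Let $Q(z)$ be a Laurent polynomial in $z = (z_1,\dots,z_d)$ with coefficients in $\mathfrak{L}(\mathfrak{G})$ for some Hilbert space $\mathfrak{G}$. Suppose that there is a $\delta > 0$ such that $Q(\zeta) \ge \delta I$ for all $\zeta \in \mathbb{T}^d$. Then $$Q(\zeta) = \sum_{j=1}^r P_j(\zeta)^* P_j(\zeta), \qquad \zeta \in \mathbb{T}^d,$$ for some (finite set of) analytic polynomials $P_1(z),\dots,P_r(z)$ in $z = (z_1,\dots,z_d)$ which have coefficients in $\mathfrak{L}(\mathfrak{G})$. Furthermore, for any fixed $k \in \{1,\dots,d\}$, the representation can be chosen such that the degree of each analytic polynomial $P_j$ in $z_k$ is no more than the degree of $Q(z)$ in $z_k$.
   Context: $\mathbb{T} = \{\zeta \in \mathbb{C} : |\zeta|=1\}$, and $\mathbb{T}^d$ is the set of $\zeta = (\zeta_1,\dots,\zeta_d)$ with $|\zeta_1| = \cdots = |\zeta_d| = 1$. $\mathfrak{L}(\mathfrak{G})$ is the space of bounded linear operators on $\mathfrak{G}$; the Hilbert space $\mathfrak{G}$ may have any dimension and need not be separable. A Laurent polynomial in $z = (z_1,\dots,z_d)$ with coefficients in $\mathfrak{L}(\mathfrak{G})$ is an expression $$Q(z) = \sum_{k_1=-m_1}^{m_1} \cdots \sum_{k_d=-m_d}^{m_d} Q_{k_1,\dots,k_d}\, z_1^{k_1}\cdots z_d^{k_d}$$ with $Q_{k_1,\dots,k_d} \in \mathfrak{L}(\mathfrak{G})$. An analytic polynomial with coefficients in $\mathfrak{L}(\mathfrak{G})$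 is an expression $$P(z) = \sum_{k_1=0}^{m_1} \cdots \sum_{k_d=0}^{m_d} P_{k_1,\dots,k_d}\, z_1^{k_1}\cdots z_d^{k_d}$$ with $P_{k_1,\dots,k_d} \in \mathfrak{L}(\mathfrak{G})$. The degrees of such a polynomial in $z_1,\dots,z_d$ are the smallest values of $m_1,\dots,m_d$ that can be used in the respective representation. *)

theory Defs
  imports "HOL-Analysis.Analysis" "HOL-Library.Poly_Mapping"
begin

section \<open>Complex Hilbert spaces\<close>

class scaleC = scaleR +
  fixes scaleC :: "complex \<Rightarrow> 'a \<Rightarrow> 'a"  (infixr "*\<^sub>C" 75)

class complex_vector = real_vector + scaleC +
  assumes scaleC_add_right: "c *\<^sub>C (x + y) = c *\<^sub>C x + c *\<^sub>C y"
    and scaleC_add_left: "(b + c) *\<^sub>C x = b *\<^sub>C x + c *\<^sub>C x"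
    and scaleC_scaleC: "b *\<^sub>C c *\<^sub>C x = (b * c) *\<^sub>C x"
    and scaleC_one: "1 *\<^sub>C x = x"
    and scaleR_scaleC: "r *\<^sub>R x = complex_of_real r *\<^sub>C x"

text \<open>The inner product is linear in the first and conjugate-linear in the second argument.
  That \<^term>\<open>cinner x x\<close> is real follows from \<open>cinner_commute\<close>, and its definiteness from
  \<open>norm_eq_sqrt_cinner\<close>.\<close>

class complex_inner = complex_vector + real_normed_vector +
  fixes cinner :: "'a \<Rightarrow> 'a \<Rightarrow> complex"
  assumes cinner_commute: "cinner x y = cnj (cinner y x)"
    and cinner_add_left: "cinner (x + y) z = cinner x z + cinner y z"
    and cinner_scaleC_left: "cinner (c *\<^sub>C x) y = c * cinner x y"
    and cinner_ge_zero: "0 \<le> Re (cinner x x)"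
    and norm_eq_sqrt_cinner: "norm x = sqrt (Re (cinner x x))"

class chilbert_space = complex_inner + complete_space

instantiation complex :: chilbert_space
begin

definition scaleC_complex :: "complex \<Rightarrow> complex \<Rightarrow> complex"
  where "scaleC_complex c x = c * x"

definition cinner_complex :: "complex \<Rightarrow> complex \<Rightarrow> complex"
  where "cinner_complex x y = x * cnj y"

instance
proof
  show "norm x = sqrt (Re (cinner x x))" for x :: complex
    by (simp add: cinner_complex_def cmod_def power2_eq_square)
qed (auto simp: scaleC_complex_def cinner_complex_def algebra_simps scaleR_conv_of_real)

end

lemma scaleC_minus_right: "c *\<^sub>C (- x) = - (c *\<^sub>C (x :: 'a::complex_vector))"
  by (metis add_cancel_right_right add.right_inverse minus_unique scaleC_add_right)

lemma scaleC_diff_right: "c *\<^sub>C (x - y) = c *\<^sub>C x - c *\<^sub>C (y :: 'a::complex_vector)"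
  by (metis diff_conv_add_uminus scaleC_add_right scaleC_minus_right)

lemma scaleC_zero_right: "c *\<^sub>C (0 :: 'a::complex_vector) = 0"
  by (metis add_cancel_right_right scaleC_add_right)

lemma scaleC_minus1_left: "(-1) *\<^sub>C x = - (x :: 'a::complex_vector)"
  using scaleR_scaleC[of "-1" x] by simp

lemma cinner_add_right:
  "cinner x (y + z) = cinner x y + cinner x (z :: 'a::complex_inner)"
  by (metis cinner_add_left cinner_commute complex_cnj_add)

lemma cinner_scaleC_right:
  "cinner x (c *\<^sub>C y) = cnj c * cinner x (y :: 'a::complex_inner)"
  by (metis cinner_scaleC_left cinner_commute complex_cnj_mult)

lemma cinner_minus_left: "cinner (- x) y = - cinner x (y :: 'a::complex_inner)"
  by (metis cinner_scaleC_left scaleC_minus1_left mult_minus1)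

lemma cinner_minus_right: "cinner x (- y) = - cinner x (y :: 'a::complex_inner)"
  by (metis cinner_minus_left cinner_commute complex_cnj_minus)

lemma cinner_diff_left:
  "cinner (x - y) z = cinner x z - cinner y (z :: 'a::complex_inner)"
  by (metis diff_conv_add_uminus cinner_add_left cinner_minus_left)

lemma cinner_diff_right:
  "cinner x (y - z) = cinner x y - cinner x (z :: 'a::complex_inner)"
  by (metis diff_conv_add_uminus cinner_add_right cinner_minus_right)

lemma cinner_zero_left [simp]: "cinner 0 (x :: 'a::complex_inner) = 0"
  by (metis cinner_diff_left diff_self)

lemma cinner_zero_right [simp]: "cinner (x :: 'a::complex_inner) 0 = 0"
  by (metis cinner_diff_right diff_self)

lemma cinner_self: "cinner x x = complex_of_real ((norm x)\<^sup>2)" for x :: "'a::complex_inner"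
proof -
  have "Im (cinner x x) = 0"
    using arg_cong[OF cinner_commute[of x x], of Im] by simp
  moreover have "(norm x)\<^sup>2 = Re (cinner x x)"
    by (simp add: norm_eq_sqrt_cinner cinner_ge_zero)
  ultimately show ?thesis by (simp add: complex_eq_iff)
qed

lemma cinner_self_eq_0_iff: "cinner x x = 0 \<longleftrightarrow> x = 0" for x :: "'a::complex_inner"
  by (simp add: cinner_self)

lemma cinner_left_ext: "(\<And>x. cinner x y = cinner x z) \<Longrightarrow> y = (z :: 'a::complex_inner)"
  by (metis cinner_diff_right cinner_self_eq_0_iff eq_iff_diff_eq_0)

lemma norm_scaleC: "norm (c *\<^sub>C x) = cmod c * norm x" for x :: "'a::complex_inner"
proof -
  have "complex_of_real ((norm (c *\<^sub>C x))\<^sup>2) = (c * cnj c) * complex_of_real ((norm x)\<^sup>2)"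
    by (simp only: cinner_self[symmetric] cinner_scaleC_left cinner_scaleC_right mult_ac)
  also have "\<dots> = complex_of_real ((cmod c * norm x)\<^sup>2)"
    by (simp only: complex_norm_square[symmetric] of_real_mult[symmetric] power_mult_distrib)
  finally have "(norm (c *\<^sub>C x))\<^sup>2 = (cmod c * norm x)\<^sup>2"
    by (simp only: of_real_eq_iff)
  then show ?thesis
    by (simp add: power2_eq_iff_nonneg)
qed

lemma norm_diff_sq:
  "(norm (x - y))\<^sup>2 = (norm x)\<^sup>2 + (norm y)\<^sup>2 - 2 * Re (cinner x (y :: 'a::complex_inner))"
proof -
  have *: "(norm z)\<^sup>2 = Re (cinner z z)" for z :: 'a by (simp add: cinner_self)
  have "Re (cinner y x) = Re (cinner x y)" by (subst cinner_commute) simp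
  then show ?thesis by (simp add: * cinner_diff_left cinner_diff_right)
qed

lemma norm_add_sq:
  "(norm (x + y))\<^sup>2 = (norm x)\<^sup>2 + (norm y)\<^sup>2 + 2 * Re (cinner x (y :: 'a::complex_inner))"
  using norm_diff_sq[of x "- y"] by (simp add: cinner_minus_right)

lemma parallelogram:
  "(norm (x + y))\<^sup>2 + (norm (x - y))\<^sup>2 = 2 * (norm x)\<^sup>2 + 2 * (norm (y :: 'a::complex_inner))\<^sup>2"
  by (simp add: norm_add_sq norm_diff_sq)

lemma Re_cinner_le: "\<bar>Re (cinner x y)\<bar> \<le> norm x * norm (y :: 'a::complex_inner)"
proof -
  have "(norm (x + y))\<^sup>2 \<le> (norm x + norm y)\<^sup>2"
    by (intro power_mono norm_triangle_ineq) simp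
  moreover have "(norm (x - y))\<^sup>2 \<le> (norm x + norm y)\<^sup>2"
    by (intro power_mono norm_triangle_ineq4) simp
  ultimately show ?thesis
    unfolding norm_add_sq norm_diff_sq by (simp add: power2_sum abs_le_iff)
qed

theorem riesz:
  fixes f :: "'a::chilbert_space \<Rightarrow> complex"
  assumes bl: "bounded_linear f" and sc: "\<And>c x. f (c *\<^sub>C x) = c * f x"
  shows "\<exists>y. \<forall>x. f x = cinner x y"
proof -
  interpret f: bounded_linear f by fact
  define \<phi> where "\<phi> x = (norm x)\<^sup>2 - 2 * Re (f x)" for x
  obtain K where K: "\<And>x. cmod (f x) \<le> norm x * K"
    using f.bounded by blast
  have lb: "- K\<^sup>2 \<le> \<phi> x" for x
  proof -
    have "Re (f x) \<le> norm x * K"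
      using K[of x] complex_Re_le_cmod[of "f x"] by linarith
    moreover have "0 \<le> (norm x - K)\<^sup>2" by simp
    ultimately show ?thesis
      by (simp add: \<phi>_def power2_diff)
  qed
  define m where "m = Inf (range \<phi>)"
  have bdd: "bdd_below (range \<phi>)" by (rule bdd_belowI[where m = "- K\<^sup>2"]) (use lb in auto)
  have m: "m \<le> \<phi> x" for x
    unfolding m_def by (rule cInf_lower[OF _ bdd]) simp
  have "\<exists>x. \<phi> x < m + 1 / real (Suc n)" for n
  proof -
    have "Inf (range \<phi>) < m + 1 / real (Suc n)" by (simp add: m_def)
    from cInf_lessD[OF _ this] show ?thesis by auto
  qed
  then obtain X where X: "\<And>n. \<phi> (X n) < m + 1 / real (Suc n)" by metis
  have par: "(norm (x - y))\<^sup>2 \<le> 2 * (\<phi> x - m) + 2 * (\<phi> y - m)" for x y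
  proof -
    have "m \<le> \<phi> ((1/2) *\<^sub>R (x + y))" by (rule m)
    also have "\<dots> = (norm (x + y))\<^sup>2 / 4 - Re (f x) - Re (f y)"
      by (simp add: \<phi>_def f.scaleR f.add power_divide add_divide_distrib)
    finally show ?thesis
      using parallelogram[of x y] by (simp add: \<phi>_def)
  qed
  have "Cauchy X"
  proof (rule metric_CauchyI)
    fix e :: real assume e: "0 < e"
    obtain N where N: "1 / real (Suc N) < e\<^sup>2 / 4"
      using nat_approx_posE[of "e\<^sup>2 / 4"] e by auto
    have "dist (X i) (X j) < e" if "i \<ge> N" "j \<ge> N" for i j
    proof -
      have "\<phi> (X k) - m < e\<^sup>2 / 4" if "k \<ge> N" for k
      proof -
        have "1 / real (Suc k) \<le> 1 / real (Suc N)" using that by (simp add: frac_le)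
        then show ?thesis using X[of k] N by linarith
      qed
      from this[OF that(1)] this[OF that(2)] par[of "X i" "X j"]
      have "(norm (X i - X j))\<^sup>2 < e\<^sup>2" by argo
      then show ?thesis using e by (simp add: dist_norm power_less_imp_less_base)
    qed
    then show "\<exists>N. \<forall>i\<ge>N. \<forall>j\<ge>N. dist (X i) (X j) < e" by blast
  qed
  then obtain y where y: "X \<longlonglongrightarrow> y"
    using Cauchy_convergent convergent_def by blast
  have "(\<lambda>n. \<phi> (X n)) \<longlonglongrightarrow> \<phi> y"
    unfolding \<phi>_def by (intro tendsto_intros y f.tendsto)
  moreover have "(\<lambda>n. \<phi> (X n)) \<longlonglongrightarrow> m"
  proof (rule tendsto_sandwich)
    show "\<forall>\<^sub>F n in sequentially. m \<le> \<phi> (X n)" using m by simp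
    show "\<forall>\<^sub>F n in sequentially. \<phi> (X n) \<le> m + 1 / real (Suc n)"
      by (intro always_eventually allI less_imp_le X)
    show "(\<lambda>n. m + 1 / real (Suc n)) \<longlonglongrightarrow> m"
      using tendsto_add[OF tendsto_const LIMSEQ_Suc[OF lim_1_over_n], of m] by simp
  qed simp
  ultimately have y_min: "\<phi> y \<le> \<phi> x" for x
    using LIMSEQ_unique m by metis
  have Re_eq: "Re (f x) = Re (cinner x y)" for x
  proof (rule ccontr)
    define a where "a = Re (cinner x y) - Re (f x)"
    define b where "b = (norm x)\<^sup>2 + 1"
    assume "Re (f x) \<noteq> Re (cinner x y)"
    then have a: "a \<noteq> 0" by (simp add: a_def)
    have b: "b > 0" unfolding b_def by (simp add: add_nonneg_pos)
    define t where "t = - a / b"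
    have "Re (cinner y (t *\<^sub>R x)) = t * Re (cinner x y)"
      by (subst cinner_commute) (simp add: scaleR_scaleC cinner_scaleC_left)
    then have "\<phi> (y + t *\<^sub>R x) = \<phi> y + t\<^sup>2 * (norm x)\<^sup>2 + 2 * t * a"
      by (simp add: \<phi>_def norm_add_sq f.add f.scaleR a_def power_mult_distrib algebra_simps)
    then have "0 \<le> t\<^sup>2 * (norm x)\<^sup>2 + 2 * t * a"
      using y_min[of "y + t *\<^sub>R x"] by linarith
    also have "\<dots> \<le> t\<^sup>2 * b + 2 * t * a"
      by (simp add: b_def algebra_simps)
    also have "\<dots> = - (a\<^sup>2 / b)"
      using b by (simp add: t_def power2_eq_square field_simps)
    finally show False using a b
      by (simp add: divide_le_0_iff)
  qed
  have "f x = cinner x y" for x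
  proof (rule complex_eqI)
    show "Re (f x) = Re (cinner x y)" by (rule Re_eq)
    have "Re (f (\<i> *\<^sub>C x)) = Re (cinner (\<i> *\<^sub>C x) y)" by (rule Re_eq)
    then show "Im (f x) = Im (cinner x y)" by (simp add: sc cinner_scaleC_left)
  qed
  then show ?thesis by blast
qed


section \<open>Bounded operators on a complex Hilbert space\<close>

typedef (overloaded) 'a bop =
  "{f :: 'a::complex_inner \<Rightarrow> 'a. bounded_linear f \<and> (\<forall>c x. f (c *\<^sub>C x) = c *\<^sub>C f x)}"
  morphisms bop_apply Bop
  by (rule exI[of _ "\<lambda>x. x"]) (simp add: bounded_linear_ident)

setup_lifting type_definition_bop

lemma bop_eqI: "(\<And>x. bop_apply A x = bop_apply B x) \<Longrightarrow> A = B"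
  by transfer auto

lemma bounded_linear_bop: "bounded_linear (bop_apply A)"
  using bop_apply[of A] by simp

lemma bop_scaleC: "bop_apply A (c *\<^sub>C x) = c *\<^sub>C bop_apply A x"
  using bop_apply[of A] by simp

instantiation bop :: (complex_inner) complex_vector
begin

lift_definition zero_bop :: "'a bop" is "\<lambda>x. 0"
  by (simp add: scaleC_zero_right)

lift_definition plus_bop :: "'a bop \<Rightarrow> 'a bop \<Rightarrow> 'a bop" is "\<lambda>A B x. A x + B x"
  by (simp add: bounded_linear_add scaleC_add_right)

lift_definition uminus_bop :: "'a bop \<Rightarrow> 'a bop" is "\<lambda>A x. - A x"
  by (simp add: bounded_linear_minus scaleC_minus_right)

lift_definition minus_bop :: "'a bop \<Rightarrow> 'a bop \<Rightarrow> 'a bop" is "\<lambda>A B x. A x - B x"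
  by (simp add: bounded_linear_sub scaleC_diff_right)

lift_definition scaleC_bop :: "complex \<Rightarrow> 'a bop \<Rightarrow> 'a bop" is "\<lambda>c A x. c *\<^sub>C A x"
proof safe
  fix c and f :: "'a \<Rightarrow> 'a"
  assume f: "bounded_linear f" and sc: "\<forall>c x. f (c *\<^sub>C x) = c *\<^sub>C f x"
  have "bounded_linear (\<lambda>y::'a. c *\<^sub>C y)"
  proof (rule bounded_linear_intro[where K = "cmod c"])
    show "c *\<^sub>C (r *\<^sub>R x) = r *\<^sub>R c *\<^sub>C x" for r and x :: 'a
      by (simp add: scaleR_scaleC scaleC_scaleC mult.commute)
  qed (simp_all add: scaleC_add_right norm_scaleC mult.commute)
  from bounded_linear_compose[OF this f] show "bounded_linear (\<lambda>x. c *\<^sub>C f x)" .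
  show "c *\<^sub>C f (b *\<^sub>C x) = b *\<^sub>C c *\<^sub>C f x" for b x
    using sc by (simp add: scaleC_scaleC mult.commute)
qed

definition scaleR_bop :: "real \<Rightarrow> 'a bop \<Rightarrow> 'a bop"
  where "scaleR_bop r A = complex_of_real r *\<^sub>C A"

instance
proof
  fix A B C :: "'a bop" and b c :: complex and r s :: real
  show "A + B + C = A + (B + C)" by transfer (simp add: add.assoc)
  show "A + B = B + A" by transfer (simp add: add.commute)
  show "0 + A = A" by transfer simp
  show "- A + A = 0" by transfer simp
  show "A - B = A + - B" by transfer simp
  show scC_r: "c *\<^sub>C (A + B) = c *\<^sub>C A + c *\<^sub>C B" for c and A B :: "'a bop"
    by transfer (simp add: scaleC_add_right)
  show scC_l: "(b + c) *\<^sub>C A = b *\<^sub>C A + c *\<^sub>C A" for b c and A :: "'a bop"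
    by transfer (simp add: scaleC_add_left)
  show scC_a: "b *\<^sub>C c *\<^sub>C A = (b * c) *\<^sub>C A" for b c and A :: "'a bop"
    by transfer (simp add: scaleC_scaleC)
  show scC_1: "1 *\<^sub>C A = A" for A :: "'a bop" by transfer (simp add: scaleC_one)
  show "r *\<^sub>R A = complex_of_real r *\<^sub>C A" by (rule scaleR_bop_def)
  show "r *\<^sub>R (A + B) = r *\<^sub>R A + r *\<^sub>R B" by (simp add: scaleR_bop_def scC_r)
  show "(r + s) *\<^sub>R A = r *\<^sub>R A + s *\<^sub>R A" by (simp add: scaleR_bop_def scC_l)
  show "r *\<^sub>R s *\<^sub>R A = (r * s) *\<^sub>R A" by (simp add: scaleR_bop_def scC_a)
  show "1 *\<^sub>R A = A" by (simp add: scaleR_bop_def scC_1)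
qed

end

text \<open>The space may be \<open>{0}\<close>, so the operators do not form a \<^class>\<open>zero_neq_one\<close>.\<close>

instantiation bop :: (complex_inner) "{ring, monoid_mult}"
begin

lift_definition one_bop :: "'a bop" is "\<lambda>x. x"
  by (simp add: bounded_linear_ident)

lift_definition times_bop :: "'a bop \<Rightarrow> 'a bop \<Rightarrow> 'a bop" is "\<lambda>A B x. A (B x)"
  by (simp add: bounded_linear_compose)

instance
proof
  fix A B C :: "'a bop"
  show "A * B * C = A * (B * C)" by transfer simp
  show "(A + B) * C = A * C + B * C" by transfer simp
  show "A * (B + C) = A * B + A * C"
    by transfer (auto simp: bounded_linear.linear linear_add)
  show "1 * A = A" "A * 1 = A" by (transfer, simp)+
qed

end

text \<open>The order on operators: \<open>A \<le> B\<close> iff \<open>\<langle>(B - A) x, x\<rangle>\<close> is real and nonnegative for all \<open>x\<close>. As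
  the space is complex, this makes \<open>B - A\<close> self-adjoint.\<close>

lemma bop_zeroI:
  fixes A :: "'a::complex_inner bop"
  assumes "\<And>x. cinner (bop_apply A x) x = 0"
  shows "A = 0"
proof (rule bop_eqI)
  fix x
  interpret A: bounded_linear "bop_apply A" by (rule bounded_linear_bop)
  have 1: "cinner (bop_apply A x) y + cinner (bop_apply A y) x = 0" for x y
    using assms[of "x + y"] assms[of x] assms[of y]
    by (simp add: A.add cinner_add_left cinner_add_right add.commute)
  have "cinner (bop_apply A x) y = 0" for y
  proof -
    have "\<i> * (cinner (bop_apply A y) x - cinner (bop_apply A x) y) = 0"
      using 1[of x "\<i> *\<^sub>C y"]
      by (simp add: bop_scaleC cinner_scaleC_left cinner_scaleC_right algebra_simps)
    then have "cinner (bop_apply A y) x = cinner (bop_apply A x) y" by simp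
    with 1[of x y] show ?thesis by simp
  qed
  then show "bop_apply A x = bop_apply 0 x"
    by (metis cinner_self_eq_0_iff zero_bop.rep_eq)
qed

instantiation bop :: (complex_inner) order
begin

definition less_eq_bop :: "'a bop \<Rightarrow> 'a bop \<Rightarrow> bool"
  where "A \<le> B \<longleftrightarrow> (\<forall>x. cinner (bop_apply (B - A) x) x \<in> \<real> \<and>
                          0 \<le> Re (cinner (bop_apply (B - A) x) x))"

definition less_bop :: "'a bop \<Rightarrow> 'a bop \<Rightarrow> bool"
  where "A < B \<longleftrightarrow> A \<le> B \<and> \<not> B \<le> (A :: 'a bop)"

instance
proof
  fix A B C :: "'a bop"
  show "A < B \<longleftrightarrow> A \<le> B \<and> \<not> B \<le> A" by (rule less_bop_def)
  show "A \<le> A" by (simp add: less_eq_bop_def zero_bop.rep_eq)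
  show "A \<le> C" if "A \<le> B" "B \<le> C"
  proof -
    have "bop_apply (C - A) x = bop_apply (C - B) x + bop_apply (B - A) x" for x
      by (simp add: minus_bop.rep_eq)
    with that show ?thesis by (auto simp: less_eq_bop_def cinner_add_left)
  qed
  show "A = B" if "A \<le> B" "B \<le> A"
  proof -
    have "B - A = 0"
    proof (rule bop_zeroI)
      fix x
      have "cinner (bop_apply (B - A) x) x = - cinner (bop_apply (A - B) x) x"
        by (simp add: minus_bop.rep_eq cinner_diff_left)
      with that have "0 \<le> Re (cinner (bop_apply (B - A) x) x)"
          "Re (cinner (bop_apply (B - A) x) x) \<le> 0"
          "cinner (bop_apply (B - A) x) x \<in> \<real>"
        by (auto simp: less_eq_bop_def dest: spec[of _ x])
      then show "cinner (bop_apply (B - A) x) x = 0"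
        by (simp add: complex_eq_iff complex_is_Real_iff)
    qed
    then show ?thesis by simp
  qed
qed

end

definition adj :: "'a::complex_inner bop \<Rightarrow> 'a bop"
  where "adj A = (THE B. \<forall>x y. cinner (bop_apply A x) y = cinner x (bop_apply B y))"

theorem cinner_adj:
  fixes A :: "'a::chilbert_space bop"
  shows "cinner (bop_apply A x) y = cinner x (bop_apply (adj A) y)"
proof -
  interpret A: bounded_linear "bop_apply A" by (rule bounded_linear_bop)
  obtain K where K: "\<And>x. norm (bop_apply A x) \<le> norm x * K" "K \<ge> 0"
    using A.nonneg_bounded by blast
  have "\<exists>z. \<forall>x. cinner (bop_apply A x) y = cinner x z" for y
  proof (rule riesz)
    show "bounded_linear (\<lambda>x. cinner (bop_apply A x) y)"
    proof (rule bounded_linear_intro[where K = "2 * K * norm y"])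
      fix x
      have ri: "\<bar>Re (cinner u y)\<bar> \<le> norm u * norm y" "\<bar>Im (cinner u y)\<bar> \<le> norm u * norm y" for u
        using Re_cinner_le[of u y] Re_cinner_le[of "\<i> *\<^sub>C u" y]
        by (simp_all add: cinner_scaleC_left norm_scaleC)
      have "cmod (cinner (bop_apply A x) y) \<le> 2 * (norm (bop_apply A x) * norm y)"
        using cmod_le[of "cinner (bop_apply A x) y"] ri[of "bop_apply A x"] by linarith
      also have "\<dots> \<le> 2 * (norm x * K * norm y)"
        using K by (intro mult_left_mono mult_right_mono) auto
      finally show "cmod (cinner (bop_apply A x) y) \<le> norm x * (2 * K * norm y)"
        by (simp add: mult_ac)
    next
      show "cinner (bop_apply A (r *\<^sub>R x)) y = r *\<^sub>R cinner (bop_apply A x) y" for r x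
        by (simp add: scaleR_scaleC[where 'a = 'a] bop_scaleC cinner_scaleC_left
            scaleR_conv_of_real)
    qed (simp add: A.add cinner_add_left)
  qed (simp add: bop_scaleC cinner_scaleC_left)
  then have "\<forall>y. \<exists>z. \<forall>x. cinner (bop_apply A x) y = cinner x z" by blast
  from choice[OF this] obtain g where g: "\<And>x y. cinner (bop_apply A x) y = cinner x (g y)"
    by blast
  have g_add: "g (x + y) = g x + g y" for x y
    by (rule cinner_left_ext) (simp add: g[symmetric] cinner_add_right)
  have g_sc: "g (c *\<^sub>C x) = c *\<^sub>C g x" for c x
    by (rule cinner_left_ext) (simp add: g[symmetric] cinner_scaleC_right)
  have "norm (g y) \<le> norm y * K" for y
  proof (cases "g y = 0")
    case False
    have "(norm (g y))\<^sup>2 = Re (cinner (bop_apply A (g y)) y)"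
      by (simp add: g cinner_self)
    also have "\<dots> \<le> norm (bop_apply A (g y)) * norm y"
      using Re_cinner_le[of "bop_apply A (g y)" y] by linarith
    also have "\<dots> \<le> norm (g y) * K * norm y"
      using K by (intro mult_right_mono) auto
    finally show ?thesis using False
      by (simp add: power2_eq_square mult_ac)
  qed (use K in simp)
  then have bl: "bounded_linear g"
    by (intro bounded_linear_intro[where K = K]) (simp_all add: g_add g_sc scaleR_scaleC)
  have Bop_g: "bop_apply (Bop g) = g" using bl g_sc by (simp add: Bop_inverse)
  have "adj A = Bop g"
    unfolding adj_def
  proof (rule the_equality)
    show "\<forall>x y. cinner (bop_apply A x) y = cinner x (bop_apply (Bop g) y)"
      unfolding Bop_g using g by blast
    fix B assume B: "\<forall>x y. cinner (bop_apply A x) y = cinner x (bop_apply B y)"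
    show "B = Bop g"
    proof (rule bop_eqI)
      fix y
      have "cinner x (bop_apply B y) = cinner x (g y)" for x
        unfolding g[symmetric] using B by simp
      then have "bop_apply B y = g y" by (rule cinner_left_ext)
      then show "bop_apply B y = bop_apply (Bop g) y" unfolding Bop_g .
    qed
  qed
  then show ?thesis by (simp only: Bop_g g)
qed


section \<open>Laurent and analytic polynomials with operator coefficients\<close>

text \<open>A polynomial is its finitely supported family of coefficients. The number of variables
  is \<open>CARD('d)\<close>.\<close>

type_synonym ('d, 'g) laurent_pol = "(int ^ 'd) \<Rightarrow>\<^sub>0 'g bop"

type_synonym ('d, 'g) analytic_pol = "(nat ^ 'd) \<Rightarrow>\<^sub>0 'g bop"

definition laurent_eval ::
    "('d::finite, 'g::complex_inner) laurent_pol \<Rightarrow> complex ^ 'd \<Rightarrow> 'g bop"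
  where "laurent_eval Q z =
    (\<Sum>k\<in>Poly_Mapping.keys Q. (\<Prod>i\<in>UNIV. z $ i powi k $ i) *\<^sub>C Poly_Mapping.lookup Q k)"

definition analytic_eval ::
    "('d::finite, 'g::complex_inner) analytic_pol \<Rightarrow> complex ^ 'd \<Rightarrow> 'g bop"
  where "analytic_eval P z =
    (\<Sum>k\<in>Poly_Mapping.keys P. (\<Prod>i\<in>UNIV. z $ i ^ k $ i) *\<^sub>C Poly_Mapping.lookup P k)"

text \<open>The degree in the \<open>i\<close>-th variable is the smallest \<open>m\<^sub>i\<close> occurring in a box
  \<open>-m\<^sub>j \<le> k\<^sub>j \<le> m\<^sub>j\<close> (respectively \<open>0 \<le> k\<^sub>j \<le> m\<^sub>j\<close>), for all \<open>j\<close>, that contains the indices of all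
  nonzero coefficients; it is 0 for the zero polynomial.\<close>

definition laurent_degree ::
    "('d::finite, 'g::complex_inner) laurent_pol \<Rightarrow> 'd \<Rightarrow> nat"
  where "laurent_degree Q i =
    (LEAST n. \<exists>m :: nat ^ 'd. m $ i = n \<and>
      (\<forall>k\<in>Poly_Mapping.keys Q. \<forall>j. - int (m $ j) \<le> k $ j \<and> k $ j \<le> int (m $ j)))"

definition analytic_degree ::
    "('d::finite, 'g::complex_inner) analytic_pol \<Rightarrow> 'd \<Rightarrow> nat"
  where "analytic_degree P i =
    (LEAST n. \<exists>m :: nat ^ 'd. m $ i = n \<and> (\<forall>k\<in>Poly_Mapping.keys P. \<forall>j. k $ j \<le> m $ j))"

definition polytorus :: "(complex ^ 'd::finite) set"
  where "polytorus = {\<zeta>. \<forall>i. cmod (\<zeta> $ i) = 1}"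

end

theory Submission
  imports Defs
begin

text \<open>The theorem rests on one observation. Suppose that a family of operators \<open>c\<^sub>\<kappa>\<close>, indexed by
  frequencies \<open>\<kappa> \<in> \<int>\<^sup>d\<close>, has a symbol \<open>\<Sum>\<^sub>\<kappa> \<zeta>\<^sup>\<kappa> c\<^sub>\<kappa>\<close> that is bounded below by \<open>\<epsilon> > 0\<close> on the torus. Then
  every finite section \<open>(c\<^bsub>j - i\<^esub>)\<close> of its Toeplitz matrix, with \<open>i\<close> and \<open>j\<close> in the cube
  \<open>{0,\<dots>,N-1}\<^sup>d\<close>, is bounded below by \<open>\<epsilon>\<close> as well, so that it has a block Cholesky factorization
  \<open>c\<^bsub>j - i\<^esub> = \<Sum>\<^sub>p P\<^bsub>p,i\<^esub>\<^sup>* P\<^bsub>p,j\<^esub>\<close>. Multiply this by \<open>\<zeta>\<^bsup>j - i\<^esup>\<close> and sum over \<open>i\<close> and \<open>j\<close>. The right-hand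
  side becomes a sum of squares of the polynomials \<open>\<Sum>\<^sub>j \<zeta>\<^sup>j P\<^bsub>p,j\<^esub>\<close>, and the left-hand side becomes
  \<open>N\<^sup>d \<Sum>\<^sub>\<kappa> w\<^sub>N(\<kappa>) \<zeta>\<^sup>\<kappa> c\<^sub>\<kappa>\<close>, because the difference \<open>\<kappa>\<close> occurs \<open>\<Prod>\<^sub>l (N - |\<kappa>\<^sub>l|) = N\<^sup>d w\<^sub>N(\<kappa>)\<close> times; here
  \<open>w\<^sub>N(\<kappa>) = \<Prod>\<^sub>l (1 - |\<kappa>\<^sub>l| / N)\<close> is the Fejer weight.

  Apply this to \<open>c\<^sub>\<kappa> = Q\<^sub>\<kappa> / w\<^sub>N(\<kappa>)\<close>. Then the left-hand side is exactly \<open>N\<^sup>d Q(\<zeta>)\<close>. As \<open>Q\<close> has finitely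
  many coefficients and \<open>w\<^sub>N(\<kappa>)\<close> tends to 1, the symbol of \<open>c\<close> is uniformly close to \<open>Q \<ge> \<delta>\<close> for large
  \<open>N\<close>, hence bounded below by \<open>\<delta>/2\<close>. This is where strict positivity is used.

  The degree bound comes from the order of elimination. If \<open>m\<close> is the degree of \<open>Q\<close> in \<open>z\<^sub>k\<close>, then the
  Toeplitz matrix is banded in direction \<open>k\<close>: its entry at \<open>(i, j)\<close> vanishes unless
  \<open>|i\<^sub>k - j\<^sub>k| \<le> m\<close>. Eliminating a pivot \<open>p\<close> with the least remaining \<open>p\<^sub>k\<close> creates no entries outside
  the band, and its row \<open>P\<^sub>p\<close> is supported in \<open>p\<^sub>k \<le> j\<^sub>k \<le> p\<^sub>k + m\<close>. Dividing the polynomial of this row by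
  \<open>\<zeta>\<^sub>k\<close> to the power \<open>p\<^sub>k\<close>, a number of modulus 1, preserves its square \<open>P\<^sup>* P\<close> and leaves an analytic
  polynomial of degree at most \<open>m\<close> in \<open>z\<^sub>k\<close>.

  The facts that carry the argument are \<open>toeplitz_form_ge\<close> (lower bounds of Toeplitz sections, by
  averaging over roots of unity), \<open>banded_cholesky\<close>, which needs the \<open>inverse_square_root\<close> of the pivot,
  \<open>sum_toeplitz_cube\<close> (the Fejer weights), and \<open>banded_factorization\<close>, which combines them.\<close>

section \<open>Bounded operators as a Banach algebra\<close>

lemma bop_apply_0 [simp]: "bop_apply A 0 = 0"
  using linear_0[OF bounded_linear.linear[OF bounded_linear_bop]] .

lemma bop_apply_sum_right: "bop_apply A (\<Sum>i\<in>I. x i) = (\<Sum>i\<in>I. bop_apply A (x i))"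
  using linear_sum[OF bounded_linear.linear[OF bounded_linear_bop]] .

lemma bop_apply_minus_right: "bop_apply A (- x) = - bop_apply A x"
  using linear_neg[OF bounded_linear.linear[OF bounded_linear_bop]] .

lemma cinner_sum_left: "cinner (\<Sum>i\<in>I. x i) y = (\<Sum>i\<in>I. cinner (x i) (y :: 'a::complex_inner))"
  by (induction I rule: infinite_finite_induct) (auto simp: cinner_add_left)

lemma cinner_sum_right: "cinner y (\<Sum>i\<in>I. x i) = (\<Sum>i\<in>I. cinner (y :: 'a::complex_inner) (x i))"
  by (induction I rule: infinite_finite_induct) (auto simp: cinner_add_right)

lemma scaleC_zero_left: "0 *\<^sub>C x = (0 :: 'a::complex_vector)"
  using scaleR_scaleC[of 0 x] by simp

lemma scaleC_sum_left: "(\<Sum>i\<in>I. c i) *\<^sub>C x = (\<Sum>i\<in>I. c i *\<^sub>C (x :: 'a::complex_vector))"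
  by (induction I rule: infinite_finite_induct) (auto simp: scaleC_add_left scaleC_zero_left)

lemma scaleC_sum_right: "c *\<^sub>C (\<Sum>i\<in>I. x i) = (\<Sum>i\<in>I. c *\<^sub>C (x i :: 'a::complex_vector))"
  by (induction I rule: infinite_finite_induct) (auto simp: scaleC_add_right scaleC_zero_right)

text \<open>The operator norm makes the operators a Banach algebra, in which power series converge. That
  algebra has no unit in the sense of \<^class>\<open>real_normed_algebra_1\<close>, since \<open>1 = 0\<close> on the trivial
  space; this is why powers need the separate estimate \<open>norm_power_bop\<close>.\<close>

instantiation bop :: (complex_inner) real_normed_vector
begin

definition norm_bop :: "'a bop \<Rightarrow> real" where "norm_bop A = onorm (bop_apply A)"
definition dist_bop :: "'a bop \<Rightarrow> 'a bop \<Rightarrow> real" where "dist_bop A B = norm (A - B)"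
definition sgn_bop :: "'a bop \<Rightarrow> 'a bop" where "sgn_bop A = A /\<^sub>R norm A"
definition uniformity_bop :: "('a bop \<times> 'a bop) filter"
  where "uniformity_bop = (INF e\<in>{0<..}. principal {(A, B). dist A B < e})"
definition open_bop :: "'a bop set \<Rightarrow> bool"
  where "open_bop U = (\<forall>A\<in>U. \<forall>\<^sub>F (A', B) in uniformity. A' = A \<longrightarrow> B \<in> U)"

instance
proof
  fix A B :: "'a bop" and r :: real
  show "norm A = 0 \<longleftrightarrow> A = 0"
    unfolding norm_bop_def onorm_eq_0[OF bounded_linear_bop]
    by (auto simp: zero_bop.rep_eq intro: bop_eqI)
  show "norm (A + B) \<le> norm A + norm B"
    unfolding norm_bop_def plus_bop.rep_eq
    by (intro onorm_triangle bounded_linear_bop)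
  have "bop_apply (r *\<^sub>R A) = (\<lambda>x. r *\<^sub>R bop_apply A x)"
    by (auto simp: scaleR_bop_def scaleC_bop.rep_eq scaleR_scaleC)
  then show "norm (r *\<^sub>R A) = \<bar>r\<bar> * norm A"
    unfolding norm_bop_def by (simp add: onorm_scaleR bounded_linear_bop)
qed (rule dist_bop_def sgn_bop_def uniformity_bop_def open_bop_def)+

end

lemma bop_apply_scaleR: "bop_apply (r *\<^sub>R A) x = r *\<^sub>R bop_apply A x"
  by (simp add: scaleR_bop_def scaleC_bop.rep_eq scaleR_scaleC)

lemma bop_apply_sum: "bop_apply (\<Sum>i\<in>I. A i) x = (\<Sum>i\<in>I. bop_apply (A i) x)"
  by (induction I rule: infinite_finite_induct) (auto simp: zero_bop.rep_eq plus_bop.rep_eq)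

lemma norm_bop_apply_le: "norm (bop_apply A x) \<le> norm A * norm x"
  unfolding norm_bop_def by (rule onorm[OF bounded_linear_bop])

lemma norm_bop_leI:
  "0 \<le> b \<Longrightarrow> (\<And>x. norm (bop_apply A x) \<le> b * norm x) \<Longrightarrow> norm A \<le> b"
  unfolding norm_bop_def by (rule onorm_bound)

lemma norm_scaleC_bop: "norm (c *\<^sub>C A) \<le> cmod c * norm (A :: 'a::complex_inner bop)"
  by (rule norm_bop_leI)
    (auto simp: scaleC_bop.rep_eq norm_scaleC mult.assoc intro: mult_left_mono norm_bop_apply_le)

instance bop :: (complex_inner) real_normed_algebra
proof
  fix A B :: "'a bop" and r :: real
  show "r *\<^sub>R A * B = r *\<^sub>R (A * B)"
    by (rule bop_eqI) (simp add: times_bop.rep_eq bop_apply_scaleR)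
  show "A * r *\<^sub>R B = r *\<^sub>R (A * B)"
    by (rule bop_eqI)
       (simp add: times_bop.rep_eq bop_apply_scaleR linear_scale bounded_linear.linear bounded_linear_bop)
  show "norm (A * B) \<le> norm A * norm B"
    using onorm_compose[OF bounded_linear_bop bounded_linear_bop, of A B]
    by (simp add: norm_bop_def times_bop.rep_eq o_def)
qed

lemma norm_one_bop: "norm (1 :: 'a::complex_inner bop) \<le> 1"
  by (rule norm_bop_leI) (auto simp: one_bop.rep_eq)

lemma norm_power_bop: "norm (A ^ n) \<le> norm (A :: 'a::complex_inner bop) ^ n"
proof (induction n)
  case (Suc n)
  have "norm (A * A ^ n) \<le> norm A * norm (A ^ n)" by (rule norm_mult_ineq)
  also have "\<dots> \<le> norm A * norm A ^ n" using Suc by (intro mult_left_mono) auto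
  finally show ?case by simp
qed (simp add: norm_one_bop)

lemma bounded_linear_scaleC: "bounded_linear (\<lambda>y::'a::complex_inner. c *\<^sub>C y)"
  by (rule bounded_linear_intro[where K = "cmod c"])
     (simp_all add: scaleC_add_right norm_scaleC scaleR_scaleC scaleC_scaleC mult.commute)

instance chilbert_space \<subseteq> banach ..

text \<open>Bounded real-linear maps form a complete space, and complex linearity survives pointwise limits.\<close>

instance bop :: (chilbert_space) banach
proof
  fix X :: "nat \<Rightarrow> 'a bop" assume X: "Cauchy X"
  define Y where "Y n = Blinfun (bop_apply (X n))" for n
  have Y: "blinfun_apply (Y n) = bop_apply (X n)" for n
    unfolding Y_def by (simp add: Blinfun_inverse bounded_linear_bop)
  have "dist (Y i) (Y j) = dist (X i) (X j)" for i j
    by (simp add: dist_norm norm_blinfun.rep_eq norm_bop_def minus_blinfun.rep_eq minus_bop.rep_eq Y)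
  with X have "Cauchy Y" unfolding Cauchy_def by simp
  then obtain L where L: "Y \<longlonglongrightarrow> L"
    using Cauchy_convergent unfolding convergent_def by blast
  have Lx: "(\<lambda>n. bop_apply (X n) x) \<longlonglongrightarrow> blinfun_apply L x" for x
    using blinfun.tendsto[OF L tendsto_const[of x]] by (simp add: Y)
  have "blinfun_apply L (c *\<^sub>C x) = c *\<^sub>C blinfun_apply L x" for c x
  proof (rule LIMSEQ_unique)
    show "(\<lambda>n. bop_apply (X n) (c *\<^sub>C x)) \<longlonglongrightarrow> blinfun_apply L (c *\<^sub>C x)" by (rule Lx)
    show "(\<lambda>n. bop_apply (X n) (c *\<^sub>C x)) \<longlonglongrightarrow> c *\<^sub>C blinfun_apply L x"
      unfolding bop_scaleC by (rule bounded_linear.tendsto[OF bounded_linear_scaleC Lx])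
  qed
  then have B: "bop_apply (Bop (blinfun_apply L)) = blinfun_apply L"
    by (simp add: Bop_inverse blinfun.bounded_linear_right)
  have "norm (X n - Bop (blinfun_apply L)) = norm (Y n - L)" for n
    by (simp add: norm_blinfun.rep_eq norm_bop_def minus_blinfun.rep_eq minus_bop.rep_eq Y B)
  with L have "X \<longlonglongrightarrow> Bop (blinfun_apply L)"
    by (simp add: LIMSEQ_iff)
  then show "convergent X" unfolding convergent_def by blast
qed


section \<open>Adjoints\<close>

lemma adj_eqI:
  fixes A B :: "'a::chilbert_space bop"
  assumes "\<And>x y. cinner (bop_apply A x) y = cinner x (bop_apply B y)"
  shows "adj A = B"
  by (rule bop_eqI, rule cinner_left_ext) (simp add: assms flip: cinner_adj)

lemma cinner_adj_right:
  fixes A :: "'a::chilbert_space bop"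
  shows "cinner x (bop_apply A y) = cinner (bop_apply (adj A) x) y"
  by (metis (no_types) cinner_adj cinner_commute[of x] cinner_commute[of _ y])

lemma adj_adj [simp]: "adj (adj A) = (A :: 'a::chilbert_space bop)"
  by (rule adj_eqI) (simp add: cinner_adj_right)

lemma adj_mult: "adj (A * B) = adj B * adj (A :: 'a::chilbert_space bop)"
  by (rule adj_eqI) (simp add: times_bop.rep_eq cinner_adj)

lemma adj_one [simp]: "adj (1 :: 'a::chilbert_space bop) = 1"
  by (rule adj_eqI) (simp add: one_bop.rep_eq)

lemma adj_zero [simp]: "adj (0 :: 'a::chilbert_space bop) = 0"
  by (rule adj_eqI) (simp add: zero_bop.rep_eq)

lemma adj_diff: "adj (A - B) = adj A - adj (B :: 'a::chilbert_space bop)"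
  by (rule adj_eqI) (simp add: minus_bop.rep_eq cinner_diff_left cinner_diff_right cinner_adj)

lemma adj_add: "adj (A + B) = adj A + adj (B :: 'a::chilbert_space bop)"
  by (rule adj_eqI) (simp add: plus_bop.rep_eq cinner_add_left cinner_add_right cinner_adj)

lemma adj_sum: "adj (\<Sum>i\<in>I. A i) = (\<Sum>i\<in>I. adj (A i :: 'a::chilbert_space bop))"
  by (induction I rule: infinite_finite_induct) (auto simp: adj_add)

lemma adj_scaleC: "adj (c *\<^sub>C A) = cnj c *\<^sub>C adj (A :: 'a::chilbert_space bop)"
  by (rule adj_eqI) (simp add: scaleC_bop.rep_eq cinner_scaleC_left cinner_scaleC_right cinner_adj)

lemma adj_scaleR: "adj (r *\<^sub>R A) = r *\<^sub>R adj (A :: 'a::chilbert_space bop)"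
  by (simp add: scaleR_bop_def adj_scaleC)

lemma adj_power: "adj (A ^ n) = adj (A :: 'a::chilbert_space bop) ^ n"
  by (induction n) (simp_all add: adj_mult power_commutes)

lemma bounded_linear_adj: "bounded_linear (adj :: 'a::chilbert_space bop \<Rightarrow> _)"
proof (rule bounded_linear_intro[where K = 1])
  fix A :: "'a bop"
  have "norm (bop_apply (adj A) x) \<le> norm A * norm x" for x
  proof (cases "bop_apply (adj A) x = 0")
    case False
    let ?y = "bop_apply (adj A) x"
    have "(norm ?y)\<^sup>2 = Re (cinner (bop_apply A ?y) x)"
      by (simp add: cinner_self cinner_adj[of A ?y x])
    also have "\<dots> \<le> norm (bop_apply A ?y) * norm x"
      using Re_cinner_le[of "bop_apply A ?y" x] by linarith
    also have "\<dots> \<le> norm A * norm ?y * norm x"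
      by (intro mult_right_mono norm_bop_apply_le) auto
    finally show ?thesis using False by (simp add: power2_eq_square mult_ac)
  qed simp
  then show "norm (adj A) \<le> norm A * 1" by (intro norm_bop_leI) auto
qed (simp_all add: adj_add adj_scaleR)

lemma bop_le_iff: "A \<le> B \<longleftrightarrow> 0 \<le> B - (A :: 'a::complex_inner bop)"
  by (simp add: less_eq_bop_def)

text \<open>On a complex space an operator is determined by its quadratic form, and the form of the adjoint
  is the conjugate of the form of the operator.\<close>

lemma bop_nonneg_selfadjoint:
  fixes A :: "'a::chilbert_space bop"
  assumes "0 \<le> A" shows "adj A = A"
proof -
  have "adj A - A = 0"
  proof (rule bop_zeroI)
    fix x
    have "cinner (bop_apply A x) x \<in> \<real>" using assms by (simp add: less_eq_bop_def)
    then have "cinner (bop_apply (adj A) x) x = cinner (bop_apply A x) x"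
      by (metis Reals_cnj_iff cinner_adj_right cinner_commute)
    then show "cinner (bop_apply (adj A - A) x) x = 0"
      by (simp add: minus_bop.rep_eq cinner_diff_left)
  qed
  then show ?thesis by simp
qed


section \<open>Inverse square roots\<close>

text \<open>These are the coefficients of the power series of \<open>1 / sqrt (1 - x)\<close>.\<close>

definition invsqrt_coeff :: "nat \<Rightarrow> real" where
  "invsqrt_coeff n = (- 1) ^ n * ((- 1 / 2) gchoose n)"

text \<open>The square of \<open>1 / sqrt (1 - x)\<close> is the geometric series; on coefficients this is Vandermonde's
  identity with both upper arguments \<open>- 1 / 2\<close>.\<close>

lemma invsqrt_coeff_convolution: "(\<Sum>k\<le>n. invsqrt_coeff k * invsqrt_coeff (n - k)) = 1"
proof -
  have "(\<Sum>k\<le>n. invsqrt_coeff k * invsqrt_coeff (n - k)) =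
      (- 1) ^ n * (\<Sum>k\<le>n. ((- 1 / 2) gchoose k) * ((- 1 / 2 :: real) gchoose (n - k)))"
    unfolding sum_distrib_left
  proof (rule sum.cong[OF refl])
    fix k assume "k \<in> {..n}"
    then have "(- 1 :: real) ^ n = (- 1) ^ k * (- 1) ^ (n - k)"
      by (simp flip: power_add)
    then show "invsqrt_coeff k * invsqrt_coeff (n - k) =
        (- 1) ^ n * (((- 1 / 2) gchoose k) * ((- 1 / 2) gchoose (n - k)))"
      by (simp add: invsqrt_coeff_def mult_ac)
  qed
  also have "\<dots> = 1"
  proof -
    have "(\<Sum>k\<le>n. ((- 1 / 2) gchoose k) * ((- 1 / 2 :: real) gchoose (n - k))) =
        ((- 1 / 2) + (- 1 / 2) gchoose n)"
      unfolding gbinomial_Vandermonde[symmetric] atLeast0AtMost ..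
    also have "\<dots> = ((- 1 :: real) gchoose n)" by simp
    also have "\<dots> = (- 1) ^ n * ((real n) gchoose n)"
      using gbinomial_minus[of "1 :: real" n] by simp
    also have "\<dots> = (- 1) ^ n" by (simp flip: binomial_gbinomial)
    finally show ?thesis by simp
  qed
  finally show ?thesis .
qed

lemma abs_invsqrt_coeff_le: "\<bar>invsqrt_coeff n\<bar> \<le> 1"
proof (induction n)
  case (Suc n)
  have "real (Suc n) * ((- 1 / 2) gchoose Suc n) = - ((1 / 2 + real n) * ((- 1 / 2) gchoose n))"
    using gbinomial_mult_1[of "- 1 / 2 :: real" n] by (simp only: distrib_right)
  then have "\<bar>real (Suc n) * ((- 1 / 2) gchoose Suc n)\<bar> = \<bar>(1 / 2 + real n) * ((- 1 / 2) gchoose n)\<bar>"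
    by (simp only: abs_minus_cancel)
  then have "real (Suc n) * \<bar>invsqrt_coeff (Suc n)\<bar> = (1 / 2 + real n) * \<bar>invsqrt_coeff n\<bar>"
    unfolding invsqrt_coeff_def abs_mult power_abs by simp
  also have "\<dots> \<le> real (Suc n) * 1"
    using Suc by (intro mult_mono) auto
  finally show ?case
    by (simp only: mult_le_cancel_left_pos of_nat_0_less_iff zero_less_Suc)
next
  case 0
  have "invsqrt_coeff 0 = 1" unfolding invsqrt_coeff_def by simp
  then show ?case by simp
qed

text \<open>For a suitable \<open>t > 0\<close> the operator \<open>X = 1 - t A\<close> is a strict contraction. So the power series of
  \<open>1 / sqrt (1 - x)\<close> converges at \<open>X\<close>, to a self-adjoint \<open>S\<close> whose square is the geometric series
  of \<open>X\<close>, that is, the inverse of \<open>t A\<close>. Then \<open>B = sqrt t S\<close> has the desired property.\<close>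

lemma inverse_square_root:
  fixes A :: "'a::chilbert_space bop"
  assumes "adj A = A" and "\<epsilon> > 0" and pos: "\<And>x. \<epsilon> * (norm x)\<^sup>2 \<le> Re (cinner (bop_apply A x) x)"
  obtains B where "A * (adj B * B) = 1" "(adj B * B) * A = 1"
proof -
  \<comment> \<open>The summand \<open>\<epsilon>\<close> keeps \<open>M\<close> positive when \<open>A = 0\<close>, which happens on the trivial space.\<close>
  define M where "M = norm A + \<epsilon>"
  have M: "M > 0" "norm A \<le> M" "\<epsilon> \<le> M" using assms(2) by (auto simp: M_def add_nonneg_pos)
  \<comment> \<open>This \<open>t\<close> minimizes the factor in
      \<open>\<parallel>x - t A x\<parallel>\<^sup>2 \<le> (1 - 2 t \<epsilon> + t\<^sup>2 M\<^sup>2) \<parallel>x\<parallel>\<^sup>2\<close>; the minimum is \<open>q\<^sup>2\<close>.\<close>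
  define t where "t = \<epsilon> / M\<^sup>2"
  define q where "q = sqrt (1 - \<epsilon>\<^sup>2 / M\<^sup>2)"
  define X where "X = 1 - t *\<^sub>R A"
  have t: "t > 0" using M assms(2) by (simp add: t_def)
  have "\<epsilon>\<^sup>2 \<le> M\<^sup>2" using M assms(2) by (intro power_mono) auto
  then have "\<epsilon>\<^sup>2 / M\<^sup>2 \<le> 1" using M(1) by simp
  moreover have "0 < \<epsilon>\<^sup>2 / M\<^sup>2" using M(1) assms(2) by simp
  ultimately have q: "0 \<le> q" "q < 1" "q\<^sup>2 = 1 - \<epsilon>\<^sup>2 / M\<^sup>2"
    unfolding q_def by (simp_all del: zero_less_divide_iff)
  have "norm (bop_apply X x) \<le> q * norm x" for x
  proof -
    have "bop_apply X x = x - t *\<^sub>R bop_apply A x"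
      by (simp add: X_def minus_bop.rep_eq one_bop.rep_eq bop_apply_scaleR)
    moreover have "Re (cinner x (t *\<^sub>R bop_apply A x)) = t * Re (cinner (bop_apply A x) x)"
      unfolding scaleR_scaleC cinner_scaleC_right
      using arg_cong[OF cinner_commute[of x "bop_apply A x"], of Re] by simp
    ultimately have "(norm (bop_apply X x))\<^sup>2 =
        (norm x)\<^sup>2 + t\<^sup>2 * (norm (bop_apply A x))\<^sup>2 - 2 * t * Re (cinner (bop_apply A x) x)"
      by (simp add: norm_diff_sq power_mult_distrib)
    also have "\<dots> \<le> (norm x)\<^sup>2 + t\<^sup>2 * (M * norm x)\<^sup>2 - 2 * t * (\<epsilon> * (norm x)\<^sup>2)"
    proof -
      have "norm (bop_apply A x) \<le> M * norm x"
        using norm_bop_apply_le[of A x] mult_right_mono[OF M(2), of "norm x"] by simp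
      then have "t\<^sup>2 * (norm (bop_apply A x))\<^sup>2 \<le> t\<^sup>2 * (M * norm x)\<^sup>2"
        by (intro mult_left_mono power_mono) auto
      moreover have "2 * t * (\<epsilon> * (norm x)\<^sup>2) \<le> 2 * t * Re (cinner (bop_apply A x) x)"
        using t by (intro mult_left_mono pos) auto
      ultimately show ?thesis by linarith
    qed
    also have "\<dots> = (q * norm x)\<^sup>2"
    proof -
      define r where "r = \<epsilon>\<^sup>2 / M\<^sup>2"
      have "t\<^sup>2 * M\<^sup>2 = r" "t * \<epsilon> = r"
        using M(1) by (simp_all add: r_def t_def power2_eq_square)
      then have 1: "t\<^sup>2 * (M * norm x)\<^sup>2 = r * (norm x)\<^sup>2"
          and 2: "2 * t * (\<epsilon> * (norm x)\<^sup>2) = 2 * (r * (norm x)\<^sup>2)"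
        unfolding power_mult_distrib
        by (simp_all only: mult.assoc[symmetric]) (simp only: mult.assoc)
      have 3: "(q * norm x)\<^sup>2 = (norm x)\<^sup>2 - r * (norm x)\<^sup>2"
        unfolding power_mult_distrib q(3) r_def[symmetric] by (simp add: left_diff_distrib)
      show ?thesis unfolding 1 2 3 by simp
    qed
    finally show ?thesis by (rule power2_le_imp_le) (simp add: q(1))
  qed
  then have X: "norm X \<le> q" using q(1) by (intro norm_bop_leI) auto
  have nX: "norm (X ^ n) \<le> q ^ n" for n
    using norm_power_bop[of X n] power_mono[OF X, of n] by simp
  have sum_pow: "summable (\<lambda>n. norm (X ^ n))"
    by (rule summable_comparison_test'[of "\<lambda>n. q ^ n" 0]) (use nX q in \<open>auto simp: summable_geometric\<close>)
  define c where "c n = invsqrt_coeff n *\<^sub>R X ^ n" for n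
  have sum_c: "summable (\<lambda>n. norm (c n))"
  proof (rule summable_comparison_test'[OF sum_pow, of 0])
    fix n
    have "\<bar>invsqrt_coeff n\<bar> * norm (X ^ n) \<le> 1 * norm (X ^ n)"
      by (intro mult_right_mono abs_invsqrt_coeff_le) auto
    then show "norm (norm (c n)) \<le> norm (X ^ n)" by (simp add: c_def)
  qed
  define S where "S = suminf c"
  define G where "G = suminf (\<lambda>n. X ^ n)"
  have "(\<Sum>i\<le>k. c i * c (k - i)) = X ^ k" for k
  proof -
    have "(\<Sum>i\<le>k. c i * c (k - i)) = (\<Sum>i\<le>k. (invsqrt_coeff i * invsqrt_coeff (k - i)) *\<^sub>R X ^ k)"
    proof (rule sum.cong[OF refl])
      fix i assume "i \<in> {..k}"
      then have "X ^ i * X ^ (k - i) = X ^ k" unfolding power_add[symmetric] by simp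
      then show "c i * c (k - i) = (invsqrt_coeff i * invsqrt_coeff (k - i)) *\<^sub>R X ^ k"
        by (simp add: c_def)
    qed
    also have "\<dots> = X ^ k"
      unfolding scaleR_sum_left[symmetric] invsqrt_coeff_convolution by simp
    finally show ?thesis .
  qed
  then have SS: "S * S = G"
    using Cauchy_product[OF sum_c sum_c] by (simp add: S_def G_def)
  have "adj X = X" using assms(1) by (simp add: X_def adj_diff adj_scaleR)
  then have adj_c: "adj (c n) = c n" for n by (simp add: c_def adj_scaleR adj_power)
  have adj_S: "adj S = S"
    using bounded_linear.suminf[OF bounded_linear_adj summable_norm_cancel[OF sum_c]]
    by (simp add: S_def adj_c)
  have sm: "summable (\<lambda>n. X ^ n)" by (rule summable_norm_cancel[OF sum_pow])
  have G: "G = 1 + suminf (\<lambda>n. X ^ Suc n)"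
    using suminf_split_head[OF sm] by (simp add: G_def)
  have "suminf (\<lambda>n. X ^ Suc n) = X * G" "suminf (\<lambda>n. X ^ Suc n) = G * X"
    using suminf_mult[OF sm, of X] suminf_mult2[OF sm, of X]
    by (simp_all add: G_def power_commutes)
  then have "G - X * G = 1" "G - G * X = 1"
    by (metis G add_diff_cancel_right')+
  then have inv: "(t *\<^sub>R A) * G = 1" "G * (t *\<^sub>R A) = 1"
    by (simp_all add: X_def algebra_simps)
  define B where "B = sqrt t *\<^sub>R S"
  have "adj B * B = t *\<^sub>R G"
    using t by (simp add: B_def adj_scaleR adj_S SS)
  with inv have "A * (adj B * B) = 1" "(adj B * B) * A = 1" by simp_all
  then show ?thesis by (rule that)
qed


section \<open>Block Cholesky factorization of banded matrices\<close>

text \<open>Gaussian elimination. The pivot \<open>p\<close> contributes the term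
  \<open>R\<^bsub>i,p\<^esub> R\<^bsub>p,p\<^esub>\<^sup>-\<^sup>1 R\<^bsub>p,j\<^esub> = P\<^bsub>p,i\<^esub>\<^sup>* P\<^bsub>p,j\<^esub>\<close>, and what remains is the Schur complement on the other indices. Its form
  is the minimum of the form of \<open>R\<close> over the component at \<open>p\<close>, so it has the same lower bound. The
  band survives if the pivot has minimal level \<open>f p\<close>: the remaining indices that it is coupled to
  then have levels between \<open>f p\<close> and \<open>f p + m\<close>, so that any two of them differ by at most \<open>m\<close>.\<close>

lemma banded_cholesky:
  fixes R :: "'i \<Rightarrow> 'i \<Rightarrow> 'a::chilbert_space bop" and f :: "'i \<Rightarrow> int"
  assumes "finite I" and eps: "\<epsilon> > 0"
    and "\<And>i j. i \<in> I \<Longrightarrow> j \<in> I \<Longrightarrow> adj (R i j) = R j i"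
    and "\<And>x. \<epsilon> * (\<Sum>i\<in>I. (norm (x i))\<^sup>2) \<le>
      Re (\<Sum>i\<in>I. \<Sum>j\<in>I. cinner (bop_apply (R i j) (x j)) (x i))"
    and "\<And>i j. i \<in> I \<Longrightarrow> j \<in> I \<Longrightarrow> R i j \<noteq> 0 \<Longrightarrow> \<bar>f i - f j\<bar> \<le> m"
  shows "\<exists>P. (\<forall>i\<in>I. \<forall>j\<in>I. R i j = (\<Sum>p\<in>I. adj (P p i) * P p j)) \<and>
    (\<forall>p\<in>I. \<forall>j\<in>I. P p j \<noteq> 0 \<longrightarrow> f p \<le> f j \<and> f j \<le> f p + m)"
  using assms(1,3-5)
proof (induction I arbitrary: R rule: finite_psubset_induct)
  case (psubset I R)
  note herm = psubset.prems(1) and pos = psubset.prems(2) and band = psubset.prems(3)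
  show ?case
  proof (cases "I = {}")
    case False
    define p where "p = arg_min_on f I"
    have p: "p \<in> I" "\<And>i. i \<in> I \<Longrightarrow> f p \<le> f i"
      using arg_min_if_finite[OF psubset.hyps False, of f] by (auto simp: p_def not_less)
    define J where "J = I - {p}"
    have J: "finite J" "p \<notin> J" "I = insert p J" "J \<subset> I"
      using p psubset.hyps by (auto simp: J_def)
    have form: "(\<Sum>i\<in>I. \<Sum>j\<in>I. cinner (bop_apply (R i j) (x j)) (x i)) =
        cinner (bop_apply (R p p) (x p)) (x p) +
        cinner (\<Sum>j\<in>J. bop_apply (R p j) (x j)) (x p) +
        (\<Sum>i\<in>J. cinner (bop_apply (R i p) (x p)) (x i)) +
        (\<Sum>i\<in>J. \<Sum>j\<in>J. cinner (bop_apply (R i j) (x j)) (x i))" for x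
      using J(1,2) by (simp add: J(3) sum.distrib cinner_sum_left)
    have "\<epsilon> * (norm v)\<^sup>2 \<le> Re (cinner (bop_apply (R p p) v) v)" for v
    proof -
      define x where "x i = (if i = p then v else 0)" for i
      have x: "x p = v" "\<And>i. i \<in> J \<Longrightarrow> x i = 0" using J(2) by (auto simp: x_def)
      have "(\<Sum>i\<in>I. (norm (x i))\<^sup>2) = (norm v)\<^sup>2"
        using J(1,2) x by (simp add: J(3))
      with pos[of x] show ?thesis unfolding form by (simp add: x)
    qed
    then obtain B where B: "R p p * (adj B * B) = 1" "(adj B * B) * R p p = 1"
      using inverse_square_root[OF herm[OF p(1) p(1)] eps] by blast
    define C where "C = adj B * B"
    define R' where "R' i j = R i j - R i p * C * R p j" for i j
    have "\<exists>P. (\<forall>i\<in>J. \<forall>j\<in>J. R' i j = (\<Sum>p\<in>J. adj (P p i) * P p j)) \<and>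
      (\<forall>p\<in>J. \<forall>j\<in>J. P p j \<noteq> 0 \<longrightarrow> f p \<le> f j \<and> f j \<le> f p + m)"
    proof (rule psubset.IH[OF J(4)])
      fix i j assume "i \<in> J" "j \<in> J"
      then have ij: "i \<in> I" "j \<in> I" using J(3) by auto
      have "adj C = C" by (simp add: C_def adj_mult)
      then show "adj (R' i j) = R' j i"
        using ij p(1) by (simp add: R'_def adj_diff adj_mult herm mult.assoc)
      assume "R' i j \<noteq> 0"
      then have "R i j \<noteq> 0 \<or> R i p \<noteq> 0 \<and> R p j \<noteq> 0"
        by (auto simp: R'_def)
      then show "\<bar>f i - f j\<bar> \<le> m"
        using band[OF ij] band[OF ij(1) p(1)] band[OF p(1) ij(2)] p(2)[OF ij(1)] p(2)[OF ij(2)]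
        by auto
    next
      fix x :: "'i \<Rightarrow> 'a"
      define s where "s = (\<Sum>j\<in>J. bop_apply (R p j) (x j))"
      \<comment> \<open>The extension of \<open>x\<close> to the index \<open>p\<close> at which the form of \<open>R\<close> is minimal.\<close>
      define y where "y = x(p := - bop_apply C s)"
      have y: "y p = - bop_apply C s" "\<And>i. i \<in> J \<Longrightarrow> y i = x i"
        using J(2) by (auto simp: y_def)
      have "\<epsilon> * (\<Sum>i\<in>J. (norm (x i))\<^sup>2) \<le> \<epsilon> * (\<Sum>i\<in>I. (norm (y i))\<^sup>2)"
        using J(1,2) eps by (simp add: J(3) y)
      also have "\<dots> \<le> Re (\<Sum>i\<in>I. \<Sum>j\<in>I. cinner (bop_apply (R i j) (y j)) (y i))"
        by (rule pos)
      also have "(\<Sum>i\<in>I. \<Sum>j\<in>I. cinner (bop_apply (R i j) (y j)) (y i)) =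
          (\<Sum>i\<in>J. cinner (bop_apply (R i p) (y p)) (x i)) +
          (\<Sum>i\<in>J. \<Sum>j\<in>J. cinner (bop_apply (R i j) (x j)) (x i))"
      proof -
        have "bop_apply (R p p) (y p) = - s"
          using arg_cong[OF B(1), of "\<lambda>A. bop_apply A s"]
          by (simp add: y bop_apply_minus_right C_def times_bop.rep_eq one_bop.rep_eq)
        then show ?thesis
          unfolding form by (simp add: y(2) s_def[symmetric] cinner_minus_left)
      qed
      also have "\<dots> = (\<Sum>i\<in>J. \<Sum>j\<in>J. cinner (bop_apply (R' i j) (x j)) (x i))"
      proof -
        have "cinner (bop_apply (R i p) (y p)) (x i) =
            - (\<Sum>j\<in>J. cinner (bop_apply (R i p * C * R p j) (x j)) (x i))" for i
          by (simp add: y(1) s_def bop_apply_minus_right bop_apply_sum_right times_bop.rep_eq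
              cinner_minus_left cinner_sum_left)
        then show ?thesis
          by (simp add: R'_def minus_bop.rep_eq cinner_diff_left sum_subtractf sum_negf)
      qed
      finally show "\<epsilon> * (\<Sum>i\<in>J. (norm (x i))\<^sup>2) \<le>
          Re (\<Sum>i\<in>J. \<Sum>j\<in>J. cinner (bop_apply (R' i j) (x j)) (x i))" .
    qed
    then obtain P' where
        P'_eq: "\<And>i j. i \<in> J \<Longrightarrow> j \<in> J \<Longrightarrow> R' i j = (\<Sum>q\<in>J. adj (P' q i) * P' q j)" and
        P'_band: "\<And>q j. q \<in> J \<Longrightarrow> j \<in> J \<Longrightarrow> P' q j \<noteq> 0 \<Longrightarrow> f q \<le> f j \<and> f j \<le> f q + m"
      by blast
    define P where "P q j = (if q = p then B * R p j else if j = p then 0 else P' q j)" for q j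
    have P: "P p j = B * R p j" "q \<in> J \<Longrightarrow> P q p = 0" "q \<in> J \<Longrightarrow> j \<in> J \<Longrightarrow> P q j = P' q j" for q j
      using J(2) by (auto simp: P_def)
    have first: "adj (P p i) * P p j = R i p * C * R p j" if "i \<in> I" for i j
      using herm[OF p(1) that] by (simp add: P(1) adj_mult C_def mult.assoc)
    have "R i j = (\<Sum>q\<in>I. adj (P q i) * P q j)" if ij: "i \<in> I" "j \<in> I" for i j
    proof -
      have "(\<Sum>q\<in>J. adj (P q i) * P q j) = (if i = p \<or> j = p then 0 else R' i j)"
        using ij P'_eq[of i j] J(3) by (auto simp: P intro!: sum.cong)
      moreover have "R p p * C * R p j = R p j" "R i p * C * R p p = R i p"
        using B by (simp_all add: C_def mult.assoc)
      ultimately show ?thesis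
        using J(1,2) first[OF ij(1), of j] by (auto simp: J(3) R'_def)
    qed
    moreover have "f q \<le> f j \<and> f j \<le> f q + m" if "q \<in> I" "j \<in> I" "P q j \<noteq> 0" for q j
    proof (cases "q = p")
      case True
      with that have "R p j \<noteq> 0" by (auto simp: P)
      with True show ?thesis using band[OF p(1) that(2)] p(2)[OF that(2)] by auto
    next
      case False
      with that show ?thesis using P'_band[of q j] J(3) by (auto simp: P_def split: if_splits)
    qed
    ultimately show ?thesis by blast
  qed simp
qed


section \<open>Trigonometric polynomials and their coefficients\<close>

text \<open>The monomial \<open>\<zeta>\<^sup>\<kappa>\<close>, which restricts to a character of the group \<^const>\<open>polytorus\<close>.\<close>

definition character :: "complex ^ 'd::finite \<Rightarrow> int ^ 'd \<Rightarrow> complex"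
  where "character \<zeta> \<kappa> = (\<Prod>l\<in>UNIV. \<zeta> $ l powi \<kappa> $ l)"

lemma polytorus_nonzero: "\<zeta> \<in> polytorus \<Longrightarrow> \<zeta> $ l \<noteq> 0"
  by (auto simp: polytorus_def dest: spec[of _ l])

lemma character_0 [simp]: "character \<zeta> 0 = 1"
  by (simp add: character_def)

lemma character_add:
  "\<zeta> \<in> polytorus \<Longrightarrow> character \<zeta> (\<kappa> + \<mu>) = character \<zeta> \<kappa> * character \<zeta> \<mu>"
  by (simp add: character_def power_int_add polytorus_nonzero prod.distrib)

lemma cnj_character:
  assumes "\<zeta> \<in> polytorus" shows "cnj (character \<zeta> \<kappa>) = character \<zeta> (- \<kappa>)"
proof -
  have "cnj (\<zeta> $ l) = inverse (\<zeta> $ l)" for l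
    using assms by (intro inverse_unique[symmetric])
      (simp add: polytorus_def flip: complex_norm_square)
  then show ?thesis
    by (simp add: character_def power_int_minus power_int_inverse)
qed

lemma character_diff:
  "\<zeta> \<in> polytorus \<Longrightarrow> character \<zeta> (\<kappa> - \<mu>) = cnj (character \<zeta> \<mu>) * character \<zeta> \<kappa>"
  using character_add[of \<zeta> \<kappa> "- \<mu>"] by (simp add: cnj_character)

lemma norm_character: "\<zeta> \<in> polytorus \<Longrightarrow> cmod (character \<zeta> \<kappa>) = 1"
  by (simp add: character_def polytorus_def norm_power_int flip: prod_norm)

text \<open>Discrete orthogonality: for \<open>0 < |k| < L\<close> this is a geometric sum over the powers of an \<open>L\<close>-th
  root of unity different from 1.\<close>

lemma sum_roots_of_unity:
  fixes k :: int and L :: nat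
  assumes "\<bar>k\<bar> < int L"
  shows "(\<Sum>s<L. cis (2 * pi * real s / real L) powi k) = (if k = 0 then of_nat L else 0)"
proof (cases "k = 0")
  case False
  define z where "z = cis (2 * pi * real_of_int k / real L)"
  have L: "L > 0" using assms by simp
  have "z \<noteq> 1"
  proof
    assume "z = 1"
    then have "cos (2 * pi * real_of_int k / real L) = 1" by (simp add: z_def complex_eq_iff)
    then obtain n :: int where n: "2 * pi * real_of_int k / real L = real_of_int n * 2 * pi"
      by (auto simp: cos_one_2pi_int)
    then have "real_of_int k = real_of_int (n * int L)" using L by (simp add: field_simps)
    then have "k = n * int L" by (simp only: of_int_eq_iff)
    with False assms show False
      by (metis abs_mult abs_of_nat dvd_imp_le_int dvd_triv_right linorder_not_less)
  qed
  moreover have "z ^ L = 1"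
  proof -
    have "real L * (2 * pi * real_of_int k / real L) = 2 * pi * real_of_int k" using L by simp
    then show ?thesis unfolding z_def Complex.DeMoivre by (simp only:) (rule cis_multiple_2pi, simp)
  qed
  moreover have "cis (2 * pi * real s / real L) powi k = z ^ s" for s
  proof -
    have "real_of_int k * (2 * pi * real s / real L) = real s * (2 * pi * real_of_int k / real L)"
      by simp
    then show ?thesis unfolding z_def Complex.DeMoivre cis_power_int by (simp only:)
  qed
  ultimately show ?thesis using False by (simp add: geometric_sum)
qed simp

text \<open>The points of the torus whose components are \<open>L\<close>-th roots of unity. Averaging over them plays
  the part of integration over the torus, and is exact as long as
  all exponents have absolute value less than \<open>L\<close>.\<close>

definition root_point :: "nat \<Rightarrow> ('d::finite \<Rightarrow> nat) \<Rightarrow> complex ^ 'd"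
  where "root_point L g = (\<chi> l. cis (2 * pi * real (g l) / real L))"

abbreviation root_grid :: "nat \<Rightarrow> ('d::finite \<Rightarrow> nat) set"
  where "root_grid L \<equiv> PiE UNIV (\<lambda>_. {..<L})"

lemma root_point_in_polytorus: "root_point L g \<in> polytorus"
  by (simp add: root_point_def polytorus_def)

lemma sum_character_root_grid:
  fixes \<kappa> :: "int ^ 'd::finite"
  assumes "\<And>l. \<bar>\<kappa> $ l\<bar> < int L"
  shows "(\<Sum>g\<in>root_grid L. character (root_point L g) \<kappa>) =
    (if \<kappa> = 0 then of_nat L ^ CARD('d) else 0)"
proof -
  have "(\<Sum>g\<in>root_grid L. character (root_point L g) \<kappa>) =
      (\<Prod>l\<in>UNIV. \<Sum>s<L. cis (2 * pi * real s / real L) powi \<kappa> $ l)"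
    by (simp add: character_def root_point_def prod_sum_PiE)
  also have "\<dots> = (\<Prod>l\<in>UNIV. if \<kappa> $ l = 0 then of_nat L else 0)"
    by (simp add: sum_roots_of_unity assms)
  also have "\<dots> = (if \<kappa> = 0 then of_nat L ^ CARD('d) else 0)"
    by (auto simp: vec_eq_iff intro!: prod_zero)
  finally show ?thesis .
qed

definition trig_poly ::
    "(int ^ 'd::finite) set \<Rightarrow> (int ^ 'd \<Rightarrow> 'a::complex_inner bop) \<Rightarrow> complex ^ 'd \<Rightarrow> 'a bop"
  where "trig_poly K c \<zeta> = (\<Sum>\<kappa>\<in>K. character \<zeta> \<kappa> *\<^sub>C c \<kappa>)"

text \<open>The bound on \<open>L\<close> excludes aliasing between \<open>\<mu>\<close> and the frequencies in \<open>K\<close>.\<close>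

lemma fourier_inversion:
  fixes c :: "int ^ 'd::finite \<Rightarrow> 'a::chilbert_space bop"
  assumes K: "finite K" "\<And>\<kappa>. \<kappa> \<notin> K \<Longrightarrow> c \<kappa> = 0"
    and L: "\<And>\<kappa> l. \<kappa> \<in> K \<Longrightarrow> \<bar>\<kappa> $ l - \<mu> $ l\<bar> < int L" "L > 0"
  shows "c \<mu> = (1 / of_nat L ^ CARD('d)) *\<^sub>C
    (\<Sum>g\<in>root_grid L. character (root_point L g) (- \<mu>) *\<^sub>C trig_poly K c (root_point L g))"
proof -
  let ?\<zeta> = "root_point L :: ('d \<Rightarrow> nat) \<Rightarrow> _"
  have "(\<Sum>g\<in>root_grid L. character (?\<zeta> g) (- \<mu>) *\<^sub>C trig_poly K c (?\<zeta> g)) =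
      (\<Sum>g\<in>root_grid L. \<Sum>\<kappa>\<in>K. character (?\<zeta> g) (\<kappa> - \<mu>) *\<^sub>C c \<kappa>)"
    by (simp add: trig_poly_def scaleC_sum_right scaleC_scaleC character_diff cnj_character
        root_point_in_polytorus)
  also have "\<dots> = (\<Sum>\<kappa>\<in>K. (\<Sum>g\<in>root_grid L. character (?\<zeta> g) (\<kappa> - \<mu>)) *\<^sub>C c \<kappa>)"
    by (subst sum.swap) (simp add: scaleC_sum_left)
  also have "\<dots> = (\<Sum>\<kappa>\<in>K. if \<kappa> = \<mu> then of_nat L ^ CARD('d) *\<^sub>C c \<kappa> else 0)"
    using L(1) by (intro sum.cong) (auto simp: sum_character_root_grid scaleC_zero_left)
  also have "\<dots> = of_nat L ^ CARD('d) *\<^sub>C c \<mu>"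
    using K by (auto simp: scaleC_zero_right)
  finally show ?thesis using L(2) by (simp add: scaleC_scaleC scaleC_one)
qed

text \<open>A single grid that is fine enough for the inversion at all frequencies in \<open>E\<close>.\<close>

lemma frequency_bound:
  fixes K E :: "(int ^ 'd::finite) set"
  assumes "finite K" "finite E"
  obtains L :: nat where "L > 0" "\<And>\<kappa> \<mu> l. \<kappa> \<in> K \<Longrightarrow> \<mu> \<in> E \<Longrightarrow> \<bar>\<kappa> $ l - \<mu> $ l\<bar> < int L"
proof -
  let ?S = "(\<lambda>(\<kappa>, \<mu>, l). \<bar>\<kappa> $ l - \<mu> $ l\<bar>) ` (K \<times> E \<times> (UNIV :: 'd set))"
  have fin: "finite (insert 0 ?S)" using assms by auto
  show ?thesis
  proof (rule that[of "nat (Max (insert 0 ?S) + 1)"])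
    have 0: "0 \<le> Max (insert 0 ?S)" using fin by simp
    then show "nat (Max (insert 0 ?S) + 1) > 0" by simp
    fix \<kappa> \<mu> l assume "\<kappa> \<in> K" "\<mu> \<in> E"
    then have "\<bar>\<kappa> $ l - \<mu> $ l\<bar> \<in> insert 0 ?S" by force
    from Max_ge[OF fin this] 0 show "\<bar>\<kappa> $ l - \<mu> $ l\<bar> < int (nat (Max (insert 0 ?S) + 1))" by simp
  qed
qed

lemma adj_fourier_coeff:
  fixes c :: "int ^ 'd::finite \<Rightarrow> 'a::chilbert_space bop"
  assumes K: "finite K" "\<And>\<kappa>. \<kappa> \<notin> K \<Longrightarrow> c \<kappa> = 0"
    and sa: "\<And>\<zeta>. \<zeta> \<in> polytorus \<Longrightarrow> adj (trig_poly K c \<zeta>) = trig_poly K c \<zeta>"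
  shows "adj (c \<mu>) = c (- \<mu>)"
proof -
  obtain L where L: "L > 0" "\<And>\<kappa> \<nu> l. \<kappa> \<in> K \<Longrightarrow> \<nu> \<in> {\<mu>, - \<mu>} \<Longrightarrow> \<bar>\<kappa> $ l - \<nu> $ l\<bar> < int L"
    using frequency_bound[OF K(1), of "{\<mu>, - \<mu>}"] by blast
  have inv: "c \<nu> = (1 / of_nat L ^ CARD('d)) *\<^sub>C
      (\<Sum>g\<in>root_grid L. character (root_point L g) (- \<nu>) *\<^sub>C trig_poly K c (root_point L g))"
    if "\<nu> \<in> {\<mu>, - \<mu>}" for \<nu>
    using K L that by (intro fourier_inversion) blast+
  show ?thesis
    by (subst (1 2) inv) (simp_all add: adj_scaleC adj_sum sa cnj_character root_point_in_polytorus)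
qed

lemma trig_poly_perturbation:
  assumes "\<zeta> \<in> polytorus"
  shows "norm (trig_poly K c \<zeta> - trig_poly K d \<zeta>) \<le> (\<Sum>\<kappa>\<in>K. norm (c \<kappa> - d \<kappa>))"
proof -
  have "trig_poly K c \<zeta> - trig_poly K d \<zeta> = (\<Sum>\<kappa>\<in>K. character \<zeta> \<kappa> *\<^sub>C (c \<kappa> - d \<kappa>))"
    by (simp add: trig_poly_def scaleC_diff_right sum_subtractf)
  also have "norm \<dots> \<le> (\<Sum>\<kappa>\<in>K. norm (c \<kappa> - d \<kappa>))"
    using norm_scaleC_bop[of "character \<zeta> _"] norm_character[OF assms] by (intro sum_norm_le) simp
  finally show ?thesis .
qed

lemma adj_mult_factor_expansion:
  fixes P :: "int ^ 'd::finite \<Rightarrow> 'a::chilbert_space bop"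
  assumes "\<zeta> \<in> polytorus"
  shows "adj (trig_poly I P \<zeta>) * trig_poly I P \<zeta> =
    (\<Sum>i\<in>I. \<Sum>j\<in>I. character \<zeta> (j - i) *\<^sub>C (adj (P i) * P j))"
proof -
  have "(a *\<^sub>C A) * (b *\<^sub>C B) = (a * b) *\<^sub>C (A * B)" for a b and A B :: "'a bop"
    by (rule bop_eqI) (simp add: scaleC_bop.rep_eq times_bop.rep_eq bop_scaleC scaleC_scaleC)
  then show ?thesis
    by (simp add: trig_poly_def adj_sum adj_scaleC sum_product character_diff[OF assms])
qed


section \<open>Toeplitz matrices\<close>

text \<open>Inserting \<open>fourier_inversion\<close> into the form turns it into the average, over the grid, of
  \<open>\<langle>F(\<zeta>) v(\<zeta>), v(\<zeta>)\<rangle>\<close>, where \<open>F\<close> is the symbol and \<open>v(\<zeta>) = \<Sum>\<^sub>j \<zeta>\<^bsup>-j\<^esup> x\<^sub>j\<close>.\<close>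

lemma toeplitz_form_nonneg:
  fixes c :: "int ^ 'd::finite \<Rightarrow> 'a::chilbert_space bop"
  assumes K: "finite K" "\<And>\<kappa>. \<kappa> \<notin> K \<Longrightarrow> c \<kappa> = 0" and I: "finite I"
    and pos: "\<And>\<zeta> v. \<zeta> \<in> polytorus \<Longrightarrow> 0 \<le> Re (cinner (bop_apply (trig_poly K c \<zeta>) v) v)"
  shows "0 \<le> Re (\<Sum>i\<in>I. \<Sum>j\<in>I. cinner (bop_apply (c (j - i)) (x j)) (x i))"
proof -
  let ?E = "(\<lambda>(i, j). j - i) ` (I \<times> I)"
  obtain L where L: "L > 0" "\<And>\<kappa> \<mu> l. \<kappa> \<in> K \<Longrightarrow> \<mu> \<in> ?E \<Longrightarrow> \<bar>\<kappa> $ l - \<mu> $ l\<bar> < int L"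
    using frequency_bound[OF K(1), of ?E] I by blast
  let ?\<zeta> = "root_point L :: ('d \<Rightarrow> nat) \<Rightarrow> _"
  let ?F = "\<lambda>g. trig_poly K c (?\<zeta> g)"
  define v where "v g = (\<Sum>j\<in>I. character (?\<zeta> g) (- j) *\<^sub>C x j)" for g
  define M where "M = (1 / real L ^ CARD('d))"
  have inv: "c (j - i) = complex_of_real M *\<^sub>C
      (\<Sum>g\<in>root_grid L. character (?\<zeta> g) (i - j) *\<^sub>C ?F g)" if "i \<in> I" "j \<in> I" for i j
    using fourier_inversion[OF K, where \<mu> = "j - i" and L = L] L that by (force simp: M_def)
  have "cinner (bop_apply (c (j - i)) (x j)) (x i) = of_real M * (\<Sum>g\<in>root_grid L.
      cinner (bop_apply (?F g) (character (?\<zeta> g) (- j) *\<^sub>C x j)) (character (?\<zeta> g) (- i) *\<^sub>C x i))"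
    if "i \<in> I" "j \<in> I" for i j
    by (simp add: inv[OF that] scaleC_bop.rep_eq bop_apply_sum cinner_scaleC_left cinner_scaleC_right
        cinner_sum_left bop_scaleC character_diff cnj_character root_point_in_polytorus mult_ac)
  then have "(\<Sum>i\<in>I. \<Sum>j\<in>I. cinner (bop_apply (c (j - i)) (x j)) (x i)) =
      (\<Sum>i\<in>I. \<Sum>j\<in>I. of_real M * (\<Sum>g\<in>root_grid L.
      cinner (bop_apply (?F g) (character (?\<zeta> g) (- j) *\<^sub>C x j)) (character (?\<zeta> g) (- i) *\<^sub>C x i)))"
    by simp
  also have "\<dots> = of_real M * (\<Sum>i\<in>I. \<Sum>j\<in>I. \<Sum>g\<in>root_grid L.
      cinner (bop_apply (?F g) (character (?\<zeta> g) (- j) *\<^sub>C x j)) (character (?\<zeta> g) (- i) *\<^sub>C x i))"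
    by (simp add: sum_distrib_left)
  also have "\<dots> = of_real M * (\<Sum>g\<in>root_grid L. \<Sum>i\<in>I. \<Sum>j\<in>I.
      cinner (bop_apply (?F g) (character (?\<zeta> g) (- j) *\<^sub>C x j)) (character (?\<zeta> g) (- i) *\<^sub>C x i))"
    unfolding sum.swap[of _ I "root_grid L"] ..
  also have "\<dots> = of_real M * (\<Sum>g\<in>root_grid L. cinner (bop_apply (?F g) (v g)) (v g))"
    unfolding v_def bop_apply_sum_right by (simp only: cinner_sum_right) (simp only: cinner_sum_left)
  finally have "Re (\<Sum>i\<in>I. \<Sum>j\<in>I. cinner (bop_apply (c (j - i)) (x j)) (x i)) =
      M * (\<Sum>g\<in>root_grid L. Re (cinner (bop_apply (?F g) (v g)) (v g)))"
    by simp
  moreover have "0 \<le> (\<Sum>g\<in>root_grid L. Re (cinner (bop_apply (?F g) (v g)) (v g)))"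
    by (intro sum_nonneg pos root_point_in_polytorus)
  moreover have "M \<ge> 0" by (simp add: M_def)
  ultimately show ?thesis by simp
qed

text \<open>Subtracting \<open>\<epsilon>\<close> from the symbol amounts to subtracting \<open>\<epsilon>\<close> from the coefficient \<open>c\<^sub>0\<close>, hence
  \<open>\<epsilon>\<close> times the identity from the Toeplitz matrix.\<close>

lemma toeplitz_form_ge:
  fixes c :: "int ^ 'd::finite \<Rightarrow> 'a::chilbert_space bop"
  assumes K: "finite K" "\<And>\<kappa>. \<kappa> \<notin> K \<Longrightarrow> c \<kappa> = 0" and I: "finite I"
    and pos: "\<And>\<zeta> v. \<zeta> \<in> polytorus \<Longrightarrow>
      \<epsilon> * (norm v)\<^sup>2 \<le> Re (cinner (bop_apply (trig_poly K c \<zeta>) v) v)"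
  shows "\<epsilon> * (\<Sum>i\<in>I. (norm (x i))\<^sup>2) \<le>
    Re (\<Sum>i\<in>I. \<Sum>j\<in>I. cinner (bop_apply (c (j - i)) (x j)) (x i))"
proof -
  define e :: "int ^ 'd \<Rightarrow> 'a bop" where "e \<kappa> = (if \<kappa> = 0 then \<epsilon> *\<^sub>R 1 else 0)" for \<kappa>
  have "trig_poly (insert 0 K) (\<lambda>\<kappa>. c \<kappa> - e \<kappa>) \<zeta> = trig_poly K c \<zeta> - \<epsilon> *\<^sub>R 1" for \<zeta>
  proof -
    have "trig_poly (insert 0 K) c \<zeta> = trig_poly K c \<zeta>"
      using K unfolding trig_poly_def
      by (intro sum.mono_neutral_right) (auto simp: scaleC_zero_right)
    moreover have "trig_poly (insert 0 K) e \<zeta> = (\<Sum>\<kappa>\<in>insert 0 K. if \<kappa> = 0 then \<epsilon> *\<^sub>R 1 else 0)"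
      unfolding trig_poly_def by (intro sum.cong) (auto simp: e_def scaleC_one scaleC_zero_right)
    ultimately show ?thesis
      using K(1) by (simp add: trig_poly_def scaleC_diff_right sum_subtractf)
  qed
  then have "0 \<le> Re (cinner (bop_apply (trig_poly (insert 0 K) (\<lambda>\<kappa>. c \<kappa> - e \<kappa>) \<zeta>) v) v)"
    if "\<zeta> \<in> polytorus" for \<zeta> v
    using pos[OF that, of v]
    by (simp add: minus_bop.rep_eq bop_apply_scaleR one_bop.rep_eq cinner_diff_left
        scaleR_scaleC[where 'a = 'a] cinner_scaleC_left cinner_self)
  then have "0 \<le> Re (\<Sum>i\<in>I. \<Sum>j\<in>I. cinner (bop_apply (c (j - i) - e (j - i)) (x j)) (x i))"
    using K I by (intro toeplitz_form_nonneg[where K = "insert 0 K"]) (auto simp: e_def)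
  also have "(\<Sum>i\<in>I. \<Sum>j\<in>I. cinner (bop_apply (c (j - i) - e (j - i)) (x j)) (x i)) =
      (\<Sum>i\<in>I. \<Sum>j\<in>I. cinner (bop_apply (c (j - i)) (x j)) (x i)) -
      (\<Sum>i\<in>I. \<Sum>j\<in>I. if i = j then of_real (\<epsilon> * (norm (x i))\<^sup>2) else 0)"
    unfolding sum_subtractf[symmetric]
    by (intro sum.cong refl)
      (auto simp: minus_bop.rep_eq cinner_diff_left e_def bop_apply_scaleR one_bop.rep_eq
        zero_bop.rep_eq scaleR_scaleC[where 'a = 'a] cinner_scaleC_left cinner_self)
  finally show ?thesis using I by (simp add: sum_distrib_left)
qed


section \<open>Fejer weights\<close>

definition cube :: "nat \<Rightarrow> (int ^ 'd::finite) set"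
  where "cube N = {i. \<forall>l. i $ l \<in> {0..<int N}}"

lemma card_vec_box:
  fixes A :: "'d::finite \<Rightarrow> 'a set"
  shows "card {v :: 'a ^ 'd. \<forall>l. v $ l \<in> A l} = (\<Prod>l\<in>UNIV. card (A l))"
proof -
  have "bij_betw vec_nth {v :: 'a ^ 'd. \<forall>l. v $ l \<in> A l} (PiE UNIV A)"
    by (rule bij_betw_byWitness[where f' = vec_lambda]) (auto simp: PiE_def)
  then show ?thesis by (simp add: bij_betw_same_card card_PiE)
qed

lemma finite_vec_box:
  fixes A :: "'d::finite \<Rightarrow> 'a set"
  assumes "\<And>l. finite (A l)"
  shows "finite {v :: 'a ^ 'd. \<forall>l. v $ l \<in> A l}"
proof -
  have "bij_betw vec_nth {v :: 'a ^ 'd. \<forall>l. v $ l \<in> A l} (PiE UNIV A)"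
    by (rule bij_betw_byWitness[where f' = vec_lambda]) (auto simp: PiE_def)
  then show ?thesis using assms by (simp add: bij_betw_finite finite_PiE)
qed

lemma finite_cube [simp]: "finite (cube N)"
  unfolding cube_def by (rule finite_vec_box) simp

text \<open>In each coordinate the cube and its translate overlap in \<open>N - |\<kappa>\<^sub>l|\<close> points.\<close>

lemma card_cube_translate:
  fixes \<kappa> :: "int ^ 'd::finite"
  assumes "\<And>l. \<bar>\<kappa> $ l\<bar> \<le> int N"
  shows "real (card {i \<in> cube N. i + \<kappa> \<in> cube N}) = (\<Prod>l\<in>UNIV. real N - \<bar>real_of_int (\<kappa> $ l)\<bar>)"
proof -
  have "{i \<in> cube N. i + \<kappa> \<in> cube N} =
      {i. \<forall>l. i $ l \<in> {max 0 (- \<kappa> $ l)..<min (int N) (int N - \<kappa> $ l)}}"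
    unfolding cube_def mem_Collect_eq all_conj_distrib[symmetric] vector_add_component
    by (intro Collect_cong all_cong1) auto
  moreover have "real (card {max 0 (- \<kappa> $ l)..<min (int N) (int N - \<kappa> $ l)}) =
      real N - \<bar>real_of_int (\<kappa> $ l)\<bar>" for l
    using assms[of l] by (auto simp: min_def max_def)
  ultimately show ?thesis by (simp only: card_vec_box of_nat_prod)
qed

text \<open>If all \<open>|\<kappa>\<^sub>l| \<le> N\<close>, this is the proportion of the cube that remains in the cube after translation
  by \<open>\<kappa>\<close>; for \<open>d = 1\<close> it is then a Fourier coefficient of the Fejer kernel.\<close>

definition fejer_weight :: "nat \<Rightarrow> int ^ 'd::finite \<Rightarrow> real"
  where "fejer_weight N \<kappa> = (\<Prod>l\<in>UNIV. 1 - \<bar>real_of_int (\<kappa> $ l)\<bar> / real N)"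

lemma fejer_weight_uminus: "fejer_weight N (- \<kappa>) = fejer_weight N \<kappa>"
  by (simp add: fejer_weight_def)

lemma fejer_weight_tendsto: "(\<lambda>N. fejer_weight N (\<kappa> :: int ^ 'd::finite)) \<longlonglongrightarrow> 1"
proof -
  have "(\<lambda>N. 1 - \<bar>real_of_int (\<kappa> $ l)\<bar> / real N) \<longlonglongrightarrow> 1" for l
    using tendsto_diff[OF tendsto_const lim_const_over_n[of "\<bar>real_of_int (\<kappa> $ l)\<bar>"], of 1] by simp
  then have "(\<lambda>N. \<Prod>l\<in>UNIV. 1 - \<bar>real_of_int (\<kappa> $ l)\<bar> / real N) \<longlonglongrightarrow> (\<Prod>l\<in>(UNIV :: 'd set). 1)"
    by (rule tendsto_prod)
  then show ?thesis by (simp add: fejer_weight_def)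
qed

lemma fejer_weight_pos:
  assumes "\<And>l. \<bar>\<kappa> $ l\<bar> < int N" shows "fejer_weight N \<kappa> > 0"
  unfolding fejer_weight_def
proof (rule prod_pos)
  fix l show "0 < 1 - \<bar>real_of_int (\<kappa> $ l)\<bar> / real N"
    using assms[of l] by (simp add: divide_less_eq) linarith
qed

text \<open>The summand depends only on \<open>\<kappa> = j - i\<close>, and by \<open>card_cube_translate\<close> each \<open>\<kappa> \<in> K\<close> occurs
  \<open>N\<^sup>d w\<^sub>N(\<kappa>)\<close> times.\<close>

lemma sum_toeplitz_cube:
  fixes c :: "int ^ 'd::finite \<Rightarrow> 'a::complex_inner bop"
  assumes K: "finite K" "\<And>\<kappa>. \<kappa> \<notin> K \<Longrightarrow> c \<kappa> = 0"
    and N: "N > 0" "\<And>\<kappa> l. \<kappa> \<in> K \<Longrightarrow> \<bar>\<kappa> $ l\<bar> \<le> int N"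
  shows "(\<Sum>i\<in>cube N. \<Sum>j\<in>cube N. character \<zeta> (j - i) *\<^sub>C c (j - i)) =
    real N ^ CARD('d) *\<^sub>R trig_poly K (\<lambda>\<kappa>. fejer_weight N \<kappa> *\<^sub>R c \<kappa>) \<zeta>"
proof -
  define h where "h \<kappa> = character \<zeta> \<kappa> *\<^sub>C c \<kappa>" for \<kappa>
  have h0: "h \<kappa> = 0" if "\<kappa> \<notin> K" for \<kappa>
    using K(2)[OF that] by (simp add: h_def scaleC_zero_right)
  have "(\<Sum>i\<in>cube N. \<Sum>j\<in>cube N. h (j - i)) =
      (\<Sum>i\<in>cube N. \<Sum>j\<in>cube N. \<Sum>\<kappa>\<in>K. if j = i + \<kappa> then h \<kappa> else 0)"
  proof (intro sum.cong refl)
    fix i j :: "int ^ 'd"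
    have "j = i + \<kappa> \<longleftrightarrow> \<kappa> = j - i" for \<kappa> by (auto simp: algebra_simps)
    then show "h (j - i) = (\<Sum>\<kappa>\<in>K. if j = i + \<kappa> then h \<kappa> else 0)"
      using K(1) h0 by simp
  qed
  also have "\<dots> = (\<Sum>\<kappa>\<in>K. \<Sum>i\<in>cube N. \<Sum>j\<in>cube N. if j = i + \<kappa> then h \<kappa> else 0)"
    unfolding sum.swap[of _ "cube N" K] ..
  also have "\<dots> = (\<Sum>\<kappa>\<in>K. real N ^ CARD('d) *\<^sub>R fejer_weight N \<kappa> *\<^sub>R h \<kappa>)"
  proof (intro sum.cong refl)
    fix \<kappa> assume \<kappa>: "\<kappa> \<in> K"
    have "(\<Sum>i\<in>cube N. \<Sum>j\<in>cube N. if j = i + \<kappa> then h \<kappa> else 0) =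
        (\<Sum>i\<in>{i \<in> cube N. i + \<kappa> \<in> cube N}. h \<kappa>)"
      by (simp add: sum.inter_filter)
    also have "\<dots> = (\<Prod>l\<in>UNIV. real N - \<bar>real_of_int (\<kappa> $ l)\<bar>) *\<^sub>R h \<kappa>"
      using card_cube_translate[OF N(2)[OF \<kappa>]] by (simp only: sum_constant_scaleR)
    also have "(\<Prod>l\<in>UNIV. real N - \<bar>real_of_int (\<kappa> $ l)\<bar>) = real N ^ CARD('d) * fejer_weight N \<kappa>"
    proof -
      have "real N - \<bar>real_of_int (\<kappa> $ l)\<bar> = real N * (1 - \<bar>real_of_int (\<kappa> $ l)\<bar> / real N)" for l
        using N(1) by (simp add: field_simps)
      then show ?thesis by (simp add: fejer_weight_def prod.distrib)
    qed
    finally show "(\<Sum>i\<in>cube N. \<Sum>j\<in>cube N. if j = i + \<kappa> then h \<kappa> else 0) =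
        real N ^ CARD('d) *\<^sub>R fejer_weight N \<kappa> *\<^sub>R h \<kappa>" by simp
  qed
  finally show ?thesis
    by (simp add: h_def trig_poly_def scaleR_sum_right scaleR_scaleC[where 'a = "'a bop"]
        scaleC_sum_right scaleC_scaleC mult_ac)
qed

text \<open>Since \<open>K\<close> is finite and the Fejer weights tend to 1, dividing the coefficients by them is a small
  perturbation for large \<open>N\<close>.\<close>

lemma inverse_fejer_scaling_bound:
  fixes c :: "int ^ 'd::finite \<Rightarrow> 'a::complex_inner bop"
  assumes K: "finite K" and "\<epsilon> > 0"
  obtains N where "N > 0" "\<And>\<kappa> l. \<kappa> \<in> K \<Longrightarrow> \<bar>\<kappa> $ l\<bar> < int N"
    "(\<Sum>\<kappa>\<in>K. norm (c \<kappa> - inverse (fejer_weight N \<kappa>) *\<^sub>R c \<kappa>)) < \<epsilon>"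
proof -
  have "(\<lambda>N. \<Sum>\<kappa>\<in>K. norm (c \<kappa> - inverse (fejer_weight N \<kappa>) *\<^sub>R c \<kappa>)) \<longlonglongrightarrow>
      (\<Sum>\<kappa>\<in>K. norm (c \<kappa> - inverse 1 *\<^sub>R c \<kappa>))"
    by (intro tendsto_sum tendsto_norm tendsto_diff tendsto_const tendsto_scaleR tendsto_inverse
        fejer_weight_tendsto) simp
  then have 1: "\<forall>\<^sub>F N in sequentially. (\<Sum>\<kappa>\<in>K. norm (c \<kappa> - inverse (fejer_weight N \<kappa>) *\<^sub>R c \<kappa>)) < \<epsilon>"
    using \<open>\<epsilon> > 0\<close> by (intro order_tendstoD(2)) auto
  have "\<forall>\<^sub>F N in sequentially. \<bar>\<kappa> $ l\<bar> < int N" for \<kappa> :: "int ^ 'd" and l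
    using eventually_gt_at_top[of "nat \<bar>\<kappa> $ l\<bar>"] by (rule eventually_mono) linarith
  then have 2: "\<forall>\<^sub>F N in sequentially. \<forall>\<kappa>\<in>K. \<forall>l\<in>UNIV. \<bar>\<kappa> $ l\<bar> < int N"
    by (intro eventually_ball_finite ballI K) auto
  obtain N where "N > 0 \<and> (\<forall>\<kappa>\<in>K. \<forall>l\<in>UNIV. \<bar>\<kappa> $ l\<bar> < int N) \<and>
      (\<Sum>\<kappa>\<in>K. norm (c \<kappa> - inverse (fejer_weight N \<kappa>) *\<^sub>R c \<kappa>)) < \<epsilon>"
    using eventually_conj[OF eventually_gt_at_top[of 0] eventually_conj[OF 2 1]]
    unfolding eventually_sequentially by blast
  then show ?thesis by (intro that[of N]) auto
qed


section \<open>Sums of squares\<close>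

text \<open>The Cholesky factorization of a Toeplitz section of the coefficients \<open>c\<^sub>\<kappa> / w\<^sub>N(\<kappa>)\<close>, read as an
  identity between polynomials.\<close>

lemma banded_factorization:
  fixes c :: "int ^ 'd::finite \<Rightarrow> 'a::chilbert_space bop"
  assumes K: "finite K" "\<And>\<kappa>. \<kappa> \<notin> K \<Longrightarrow> c \<kappa> = 0"
    and "\<delta> > 0" and pos: "\<And>\<zeta>. \<zeta> \<in> polytorus \<Longrightarrow> \<delta> *\<^sub>R 1 \<le> trig_poly K c \<zeta>"
    and m: "\<And>\<kappa>. \<kappa> \<in> K \<Longrightarrow> \<bar>\<kappa> $ k\<bar> \<le> m"
  obtains N P where
    "\<And>\<zeta>. \<zeta> \<in> polytorus \<Longrightarrow> trig_poly K c \<zeta> =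
      (\<Sum>p\<in>cube N. adj (trig_poly (cube N) (P p) \<zeta>) * trig_poly (cube N) (P p) \<zeta>)"
    "\<And>p j. p \<in> cube N \<Longrightarrow> j \<in> cube N \<Longrightarrow> P p j \<noteq> 0 \<Longrightarrow> p $ k \<le> j $ k \<and> j $ k \<le> p $ k + m"
proof -
  have "\<delta> / 2 > 0" using \<open>\<delta> > 0\<close> by simp
  then obtain N where N: "N > 0" "\<And>\<kappa> l. \<kappa> \<in> K \<Longrightarrow> \<bar>\<kappa> $ l\<bar> < int N"
      "(\<Sum>\<kappa>\<in>K. norm (c \<kappa> - inverse (fejer_weight N \<kappa>) *\<^sub>R c \<kappa>)) < \<delta> / 2"
    using inverse_fejer_scaling_bound[OF K(1)] by blast
  \<comment> \<open>Dividing by the weights in advance cancels those that \<open>sum_toeplitz_cube\<close> produces.\<close>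
  define c' where "c' \<kappa> = inverse (fejer_weight N \<kappa>) *\<^sub>R c \<kappa>" for \<kappa>
  have c'0: "c' \<kappa> = 0" if "\<kappa> \<notin> K" for \<kappa> using K(2)[OF that] by (simp add: c'_def)
  have c_c': "fejer_weight N \<kappa> *\<^sub>R c' \<kappa> = c \<kappa>" if "\<kappa> \<in> K" for \<kappa>
    using fejer_weight_pos[of \<kappa> N] N(2)[OF that] by (simp add: c'_def)
  \<comment> \<open>This makes the Toeplitz matrix of \<open>c\<close> self-adjoint, and then that of \<open>c'\<close>, as the weights are
      real and even.\<close>
  have "adj (trig_poly K c \<zeta>) = trig_poly K c \<zeta>" if "\<zeta> \<in> polytorus" for \<zeta>
  proof -
    have "adj (trig_poly K c \<zeta> - \<delta> *\<^sub>R 1) = trig_poly K c \<zeta> - \<delta> *\<^sub>R 1"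
      using pos[OF that] by (intro bop_nonneg_selfadjoint) (simp add: bop_le_iff[of "\<delta> *\<^sub>R 1"])
    then show ?thesis by (simp add: adj_diff adj_scaleR)
  qed
  then have adj_c: "adj (c \<mu>) = c (- \<mu>)" for \<mu>
    using adj_fourier_coeff[where K = K and c = c and \<mu> = \<mu>] K by blast
  have pos': "\<delta> / 2 * (norm v)\<^sup>2 \<le> Re (cinner (bop_apply (trig_poly K c' \<zeta>) v) v)"
    if "\<zeta> \<in> polytorus" for \<zeta> v
  proof -
    let ?D = "trig_poly K c \<zeta> - trig_poly K c' \<zeta>"
    have "norm ?D \<le> \<delta> / 2"
      using trig_poly_perturbation[OF that, of K c c'] N(3) by (simp add: c'_def)
    then have "norm ?D * norm v * norm v \<le> \<delta> / 2 * norm v * norm v"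
      by (intro mult_right_mono) auto
    moreover have "Re (cinner (bop_apply ?D v) v) \<le> norm ?D * norm v * norm v"
      using Re_cinner_le[of "bop_apply ?D v" v]
        mult_right_mono[OF norm_bop_apply_le[of ?D v], of "norm v"] by simp
    moreover have "\<delta> * (norm v)\<^sup>2 \<le> Re (cinner (bop_apply (trig_poly K c \<zeta>) v) v)"
    proof -
      have "0 \<le> Re (cinner (bop_apply (trig_poly K c \<zeta> - \<delta> *\<^sub>R 1) v) v)"
        using pos[OF that] by (simp add: less_eq_bop_def)
      then show ?thesis
        by (simp add: minus_bop.rep_eq bop_apply_scaleR one_bop.rep_eq cinner_diff_left
          scaleR_scaleC[where 'a = 'a] cinner_scaleC_left cinner_self)
    qed
    ultimately show ?thesis
      by (simp add: minus_bop.rep_eq cinner_diff_left power2_eq_square)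
  qed
  define M where "M = real N ^ CARD('d)"
  have M: "M > 0" using N(1) by (simp add: M_def)
  define R where "R i j = inverse M *\<^sub>R c' (j - i)" for i j
  have "\<exists>P. (\<forall>i\<in>cube N. \<forall>j\<in>cube N. R i j = (\<Sum>p\<in>cube N. adj (P p i) * P p j)) \<and>
    (\<forall>p\<in>cube N. \<forall>j\<in>cube N. P p j \<noteq> 0 \<longrightarrow> p $ k \<le> j $ k \<and> j $ k \<le> p $ k + m)"
  proof (rule banded_cholesky[where f = "\<lambda>i. i $ k"])
    show "inverse M * (\<delta> / 2) > 0" using M \<open>\<delta> > 0\<close> by simp
    show "adj (R i j) = R j i" for i j
      using fejer_weight_uminus[of N "i - j"]
      by (simp add: R_def c'_def adj_scaleR adj_c)
    show "\<bar>i $ k - j $ k\<bar> \<le> m" if "R i j \<noteq> 0" for i j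
    proof -
      have "j - i \<in> K" using that c'0[of "j - i"] by (auto simp: R_def)
      from m[OF this] show ?thesis by (simp add: abs_minus_commute)
    qed
    show "inverse M * (\<delta> / 2) * (\<Sum>i\<in>cube N. (norm (x i))\<^sup>2) \<le>
        Re (\<Sum>i\<in>cube N. \<Sum>j\<in>cube N. cinner (bop_apply (R i j) (x j)) (x i))" for x
    proof -
      have "inverse M * (\<delta> / 2 * (\<Sum>i\<in>cube N. (norm (x i))\<^sup>2)) \<le>
        inverse M * Re (\<Sum>i\<in>cube N. \<Sum>j\<in>cube N. cinner (bop_apply (c' (j - i)) (x j)) (x i))"
        using M by (intro mult_left_mono toeplitz_form_ge[OF K(1) c'0] pos') auto
      also have "\<dots> = Re (\<Sum>i\<in>cube N. \<Sum>j\<in>cube N. cinner (bop_apply (R i j) (x j)) (x i))"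
        by (simp add: R_def bop_apply_scaleR scaleR_scaleC[where 'a = 'a] cinner_scaleC_left
            sum_distrib_left flip: of_real_inverse)
      finally show ?thesis by (simp add: mult.assoc)
    qed
  qed simp
  then obtain P where P:
      "\<And>i j. i \<in> cube N \<Longrightarrow> j \<in> cube N \<Longrightarrow> R i j = (\<Sum>p\<in>cube N. adj (P p i) * P p j)"
      "\<And>p j. p \<in> cube N \<Longrightarrow> j \<in> cube N \<Longrightarrow> P p j \<noteq> 0 \<Longrightarrow> p $ k \<le> j $ k \<and> j $ k \<le> p $ k + m"
    by blast
  show ?thesis
  proof (rule that)
    fix \<zeta> :: "complex ^ 'd" assume \<zeta>: "\<zeta> \<in> polytorus"
    have "M *\<^sub>R trig_poly K c \<zeta> = M *\<^sub>R trig_poly K (\<lambda>\<kappa>. fejer_weight N \<kappa> *\<^sub>R c' \<kappa>) \<zeta>"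
      by (simp add: trig_poly_def c_c')
    also have "\<dots> = (\<Sum>i\<in>cube N. \<Sum>j\<in>cube N. character \<zeta> (j - i) *\<^sub>C c' (j - i))"
      unfolding M_def using N(1) less_imp_le[OF N(2)]
      by (intro sum_toeplitz_cube[symmetric] K(1) c'0) auto
    also have "\<dots> = (\<Sum>i\<in>cube N. \<Sum>j\<in>cube N. M *\<^sub>R character \<zeta> (j - i) *\<^sub>C R i j)"
    proof (intro sum.cong refl)
      fix i j :: "int ^ 'd"
      have "of_real M * (character \<zeta> (j - i) * of_real (inverse M)) = character \<zeta> (j - i)"
        using M by simp
      then show "character \<zeta> (j - i) *\<^sub>C c' (j - i) = M *\<^sub>R character \<zeta> (j - i) *\<^sub>C R i j"
        unfolding R_def scaleR_scaleC[where 'a = "'a bop"] scaleC_scaleC by (simp only:)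
    qed
    finally have "trig_poly K c \<zeta> = (\<Sum>i\<in>cube N. \<Sum>j\<in>cube N. character \<zeta> (j - i) *\<^sub>C R i j)"
      using M by (simp flip: scaleR_sum_right)
    also have "\<dots> = (\<Sum>i\<in>cube N. \<Sum>j\<in>cube N. \<Sum>p\<in>cube N. character \<zeta> (j - i) *\<^sub>C (adj (P p i) * P p j))"
      by (simp add: P(1) scaleC_sum_right)
    also have "\<dots> = (\<Sum>p\<in>cube N. \<Sum>i\<in>cube N. \<Sum>j\<in>cube N. character \<zeta> (j - i) *\<^sub>C (adj (P p i) * P p j))"
      by (subst (2) sum.swap, subst sum.swap) simp
    finally show "trig_poly K c \<zeta> =
        (\<Sum>p\<in>cube N. adj (trig_poly (cube N) (P p) \<zeta>) * trig_poly (cube N) (P p) \<zeta>)"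
      by (simp add: adj_mult_factor_expansion[OF \<zeta>])
  qed (rule P(2))
qed

text \<open>The minimum that defines the degree is attained, because some box contains the finitely many keys.\<close>

lemma laurent_degree_bound:
  fixes Q :: "('d::finite, 'g::complex_inner) laurent_pol"
  assumes "\<kappa> \<in> Poly_Mapping.keys Q"
  shows "\<bar>\<kappa> $ k\<bar> \<le> int (laurent_degree Q k)"
proof -
  let ?bound = "\<lambda>m :: nat ^ 'd. \<forall>\<kappa>\<in>Poly_Mapping.keys Q. \<forall>j. - int (m $ j) \<le> \<kappa> $ j \<and> \<kappa> $ j \<le> int (m $ j)"
  have "?bound (\<chi> l. nat (\<Sum>\<kappa>\<in>Poly_Mapping.keys Q. \<bar>\<kappa> $ l\<bar>))"
  proof (intro ballI allI)
    fix \<mu> l assume "\<mu> \<in> Poly_Mapping.keys Q"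
    then have "\<bar>\<mu> $ l\<bar> \<le> (\<Sum>\<kappa>\<in>Poly_Mapping.keys Q. \<bar>\<kappa> $ l\<bar>)"
      by (intro member_le_sum) auto
    then show "- int ((\<chi> l. nat (\<Sum>\<kappa>\<in>Poly_Mapping.keys Q. \<bar>\<kappa> $ l\<bar>)) $ l) \<le> \<mu> $ l \<and>
        \<mu> $ l \<le> int ((\<chi> l. nat (\<Sum>\<kappa>\<in>Poly_Mapping.keys Q. \<bar>\<kappa> $ l\<bar>)) $ l)"
      by auto
  qed
  then have "\<exists>n. \<exists>m :: nat ^ 'd. m $ k = n \<and> ?bound m" by blast
  from LeastI_ex[OF this] obtain m :: "nat ^ 'd" where "m $ k = laurent_degree Q k" "?bound m"
    unfolding laurent_degree_def by blast
  with assms have "- int (laurent_degree Q k) \<le> \<kappa> $ k \<and> \<kappa> $ k \<le> int (laurent_degree Q k)"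
    by metis
  then show ?thesis by auto
qed

text \<open>Shifting the exponents of \<open>z\<^sub>k\<close> down by \<open>a\<close> makes them range over \<open>0,\<dots>,m\<close>.\<close>

lemma analytic_polynomial_of_trig_poly:
  fixes P :: "int ^ 'd::finite \<Rightarrow> 'a::complex_inner bop" and a :: int and m :: nat
  assumes P: "\<And>j. j \<in> cube N \<Longrightarrow> P j \<noteq> 0 \<Longrightarrow> a \<le> j $ k \<and> j $ k \<le> a + int m"
  obtains A :: "('d, 'a) analytic_pol" where
    "\<And>\<zeta>. \<zeta> \<in> polytorus \<Longrightarrow> trig_poly (cube N) P \<zeta> = (\<zeta> $ k powi a) *\<^sub>C analytic_eval A \<zeta>"
    "analytic_degree A k \<le> m"
proof -
  define s :: "nat ^ 'd \<Rightarrow> int ^ 'd" where "s n = (\<chi> l. int (n $ l) + (if l = k then a else 0))" for n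
  have inj: "inj s" by (auto simp: inj_def s_def vec_eq_iff)
  define A where "A = Abs_poly_mapping (\<lambda>n. if s n \<in> cube N then P (s n) else 0)"
  have "finite (s -` cube N)" by (rule finite_vimageI[OF finite_cube inj])
  then have "finite {n. (if s n \<in> cube N then P (s n) else 0) \<noteq> 0}"
    by (rule finite_subset[rotated]) auto
  then have look: "Poly_Mapping.lookup A = (\<lambda>n. if s n \<in> cube N then P (s n) else 0)"
    unfolding A_def by (rule lookup_Abs_poly_mapping)
  then have keys: "n \<in> Poly_Mapping.keys A \<longleftrightarrow> s n \<in> cube N \<and> P (s n) \<noteq> 0" for n
    by (simp add: in_keys_iff)
  show ?thesis
  proof (rule that)
    fix \<zeta> :: "complex ^ 'd" assume \<zeta>: "\<zeta> \<in> polytorus"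
    have char: "character \<zeta> (s n) = (\<zeta> $ k powi a) * (\<Prod>l\<in>UNIV. \<zeta> $ l ^ n $ l)" for n
    proof -
      have "character \<zeta> (s n) = (\<Prod>l\<in>UNIV. \<zeta> $ l ^ n $ l * (if l = k then \<zeta> $ l powi a else 1))"
        unfolding character_def s_def
        by (intro prod.cong refl) (auto simp: power_int_add polytorus_nonzero[OF \<zeta>])
      then show ?thesis by (simp add: prod.distrib)
    qed
    have "trig_poly (cube N) P \<zeta> = (\<Sum>j\<in>s ` Poly_Mapping.keys A. character \<zeta> j *\<^sub>C P j)"
      unfolding trig_poly_def
    proof (rule sum.mono_neutral_right)
      show "s ` Poly_Mapping.keys A \<subseteq> cube N" using keys by auto
      have "P j = 0" if "j \<in> cube N" "j \<notin> s ` Poly_Mapping.keys A" for j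
      proof (rule ccontr)
        assume nz: "P j \<noteq> 0"
        define n where "n = (\<chi> l. nat (j $ l - (if l = k then a else 0)))"
        have "s n = j"
          using P[OF that(1) nz] that(1) by (auto simp: s_def n_def vec_eq_iff cube_def)
        with that nz keys[of n] show False by auto
      qed
      then show "\<forall>j\<in>cube N - s ` Poly_Mapping.keys A. character \<zeta> j *\<^sub>C P j = 0"
        by (simp add: scaleC_zero_right)
    qed simp
    also have "\<dots> = (\<Sum>n\<in>Poly_Mapping.keys A. character \<zeta> (s n) *\<^sub>C P (s n))"
      using inj by (simp add: sum.reindex inj_on_subset)
    also have "\<dots> = (\<zeta> $ k powi a) *\<^sub>C analytic_eval A \<zeta>"
      unfolding analytic_eval_def scaleC_sum_right
      by (intro sum.cong refl) (auto simp: char keys look scaleC_scaleC)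
    finally show "trig_poly (cube N) P \<zeta> = (\<zeta> $ k powi a) *\<^sub>C analytic_eval A \<zeta>" .
  next
    have "n $ l \<le> (if l = k then m else N)" if "n \<in> Poly_Mapping.keys A" for n l
    proof -
      have "s n \<in> cube N" "P (s n) \<noteq> 0" using that keys by auto
      moreover from this have "s n $ k \<le> a + int m" using P by blast
      moreover have "s n $ l < int N" using \<open>s n \<in> cube N\<close> by (simp add: cube_def)
      ultimately show ?thesis by (auto simp: s_def)
    qed
    then show "analytic_degree A k \<le> m"
      unfolding analytic_degree_def
      by (intro Least_le exI[of _ "\<chi> l. if l = k then m else N"]) auto
  qed
qed

theorem theorem5p1:
  fixes Q :: "('d::finite, 'g::chilbert_space) laurent_pol" and \<delta> :: real
  assumes "\<delta> > 0"
    and "\<And>\<zeta>. \<zeta> \<in> polytorus \<Longrightarrow> laurent_eval Q \<zeta> \<ge> \<delta> *\<^sub>R 1"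
  shows "(\<exists>Ps :: ('d, 'g) analytic_pol list. \<forall>\<zeta>\<in>polytorus.
      laurent_eval Q \<zeta> = (\<Sum>P\<leftarrow>Ps. adj (analytic_eval P \<zeta>) * analytic_eval P \<zeta>)) \<and>
    (\<forall>k. \<exists>Ps :: ('d, 'g) analytic_pol list.
      (\<forall>\<zeta>\<in>polytorus.
        laurent_eval Q \<zeta> = (\<Sum>P\<leftarrow>Ps. adj (analytic_eval P \<zeta>) * analytic_eval P \<zeta>)) \<and>
      (\<forall>P\<in>set Ps. analytic_degree P k \<le> laurent_degree Q k))"
proof -
  have eval: "laurent_eval Q \<zeta> = trig_poly (Poly_Mapping.keys Q) (Poly_Mapping.lookup Q) \<zeta>" for \<zeta>
    by (simp add: laurent_eval_def trig_poly_def character_def)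
  have "\<exists>Ps :: ('d, 'g) analytic_pol list.
      (\<forall>\<zeta>\<in>polytorus.
        laurent_eval Q \<zeta> = (\<Sum>P\<leftarrow>Ps. adj (analytic_eval P \<zeta>) * analytic_eval P \<zeta>)) \<and>
      (\<forall>P\<in>set Ps. analytic_degree P k \<le> laurent_degree Q k)" for k
  proof -
    obtain N P where
        P_eq: "\<And>\<zeta>. \<zeta> \<in> polytorus \<Longrightarrow> laurent_eval Q \<zeta> =
          (\<Sum>p\<in>cube N. adj (trig_poly (cube N) (P p) \<zeta>) * trig_poly (cube N) (P p) \<zeta>)" and
        P_band: "\<And>p j. p \<in> cube N \<Longrightarrow> j \<in> cube N \<Longrightarrow> P p j \<noteq> 0 \<Longrightarrow>
          p $ k \<le> j $ k \<and> j $ k \<le> p $ k + int (laurent_degree Q k)"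
    proof (rule banded_factorization)
      show "finite (Poly_Mapping.keys Q)" by simp
      show "Poly_Mapping.lookup Q \<kappa> = 0" if "\<kappa> \<notin> Poly_Mapping.keys Q" for \<kappa>
        using that by (simp add: in_keys_iff)
      show "\<delta> > 0" by fact
      show "\<delta> *\<^sub>R 1 \<le> trig_poly (Poly_Mapping.keys Q) (Poly_Mapping.lookup Q) \<zeta>"
        if "\<zeta> \<in> polytorus" for \<zeta>
        using assms(2)[OF that] by (simp only: eval)
      show "\<bar>\<kappa> $ k\<bar> \<le> int (laurent_degree Q k)" if "\<kappa> \<in> Poly_Mapping.keys Q" for \<kappa>
        using that by (rule laurent_degree_bound)
    qed (simp add: eval)
    have "\<exists>A :: ('d, 'g) analytic_pol. (\<forall>\<zeta>\<in>polytorus.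
        trig_poly (cube N) (P p) \<zeta> = (\<zeta> $ k powi (p $ k)) *\<^sub>C analytic_eval A \<zeta>) \<and>
        analytic_degree A k \<le> laurent_degree Q k" if "p \<in> cube N" for p
      using analytic_polynomial_of_trig_poly[of N "P p" "p $ k" k "laurent_degree Q k"] P_band[OF that]
      by metis
    then obtain A :: "int ^ 'd \<Rightarrow> ('d, 'g) analytic_pol" where
        A_eval: "\<And>p \<zeta>. p \<in> cube N \<Longrightarrow> \<zeta> \<in> polytorus \<Longrightarrow>
          trig_poly (cube N) (P p) \<zeta> = (\<zeta> $ k powi (p $ k)) *\<^sub>C analytic_eval (A p) \<zeta>" and
        A_degree: "\<And>p. p \<in> cube N \<Longrightarrow> analytic_degree (A p) k \<le> laurent_degree Q k"
      by metis
    obtain ps :: "(int ^ 'd) list" where ps: "set ps = cube N" "distinct ps"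
      using finite_distinct_list[OF finite_cube] by blast
    \<comment> \<open>The monomial factors \<open>\<zeta>\<^sub>k\<close> to the power \<open>p\<^sub>k\<close> have modulus 1 and drop out of the squares.\<close>
    have "laurent_eval Q \<zeta> = (\<Sum>P\<leftarrow>map A ps. adj (analytic_eval P \<zeta>) * analytic_eval P \<zeta>)"
      if \<zeta>: "\<zeta> \<in> polytorus" for \<zeta>
    proof -
      have "adj (u *\<^sub>C X) * (u *\<^sub>C X) = adj X * X" if "cmod u = 1" for u and X :: "'g bop"
      proof -
        have "adj (u *\<^sub>C X) * (u *\<^sub>C X) = (cnj u * u) *\<^sub>C (adj X * X)"
          by (rule bop_eqI)
            (simp add: adj_scaleC scaleC_bop.rep_eq times_bop.rep_eq bop_scaleC scaleC_scaleC)
        also have "cnj u * u = 1"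
          using that complex_norm_square[of u] by (simp add: mult.commute)
        finally show ?thesis by (simp add: scaleC_one)
      qed
      moreover have "cmod (\<zeta> $ k powi a) = 1" for a
        using \<zeta> by (simp add: polytorus_def norm_power_int)
      ultimately show ?thesis
        using ps by (simp add: P_eq[OF \<zeta>] A_eval[OF _ \<zeta>] o_def sum_list_distinct_conv_sum_set)
    qed
    then show ?thesis using A_degree ps by (intro exI[of _ "map A ps"]) auto
  qed
  then show ?thesis by blast
qed

end
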